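(* Let $N\ge1$ be an integer and let $g\in S_0(\mathbb{R})\setminus\{0\}$. For every $\varphi\in S_N$ and every $f\in S_0(\mathbb{R})$, it holds that $$\varphi=\frac{1}{N\|g\|_2^2}\sum_{n=0}^{N-1}\left(\int_{\mathbb{T}_N^2}\mathbf{V}_g\varphi(x,\xi)\,e^{2\pi i\xi\frac nN}\,\mathbf{Z}g\left(\frac nN-x,-\xi\right)dx\,d\xi\right)\epsilon_n,$$ and $$\mathbf{\Sigma}_N f=\frac{1}{\|g\|_2^2}\int_{\mathbb{T}_N^2}\mathbf{V}_g(\mathbf{\Sigma}_N f)(x,\xi)\,\mathbf{\Sigma}_N\big(\pi(x,\xi)g\big)\,dx\,d\xi,$$ where the latter integral is understood in the weak-$*$ sense, i.e. after pairing with an arbitrary $h\in S_0(\mathbb{R})$.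
   Context: For $x,\xi\in\mathbb{R}$ let $\mathbf{T}_x f(t)=f(t-x)$, $\mathbf{M}_\xi f(t)=e^{2\pi i\xi t}f(t)$ and $\pi(x,\xi)=\mathbf{M}_\xi\mathbf{T}_x$. For $f,g\in L^2(\mathbb{R})$ the short-time Fourier transform (STFT) is $\mathbf{V}_g f(x,\xi)=\langle f,\pi(x,\xi)g\rangle$. With $h_0(t)=e^{-\pi t^2}$, the Feichtinger algebra is $S_0(\mathbb{R})=\{f\in L^2(\mathbb{R}):\mathbf{V}_{h_0}f\in L^1(\mathbb{R}^2)\}$ with norm $\|f\|_{S_0}=\|\mathbf{V}_{h_0}f\|_{L^1(\mathbb{R}^2)}$; its dual is $S_0'(\mathbb{R})$. The duality pairing $\langle\cdot,\cdot\rangle_{S_0'\times S_0}$ is linear in the first and antilinear in the second argument (so $\langle\delta_t,g\rangle=\overline{g(t)}$). For $\varphi\in S_0'(\mathbb{R})$ and $g\in S_0(\mathbb{R})$, the STFT is $\mathbf{V}_g\varphi(x,\xi)=\langle\varphi,\pi(x,\xi)g\rangle_{S_0'\times S_0}$. $S_N\subset S_0'(\mathbb{R})$ is the linear span of the delta trains $\epsilon_n=\sum_{k\in\mathbb{Z}}\delta_{\frac nN+k}$, $n=0,\dots,N-1$, which form a basis of $S_N$. The double periodization operator is $\mathbf{\Sigma}_N f=\sum_{k_1,k_2\in\mathbb{Z}}\mathbf{M}_{Nk_2}\mathbf{T}_{k_1}f$ for $f\in S_0(\mathbb{R})$, the series converging unconditionally in the weak-$*$ sense in $S_0'(\mathbb{R})$.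 The Zak transform is $\mathbf{Z}f(x,\xi)=\sum_{k\in\mathbb{Z}}f(x-k)e^{2\pi ik\xi}$. $\mathbb{T}_N^2=\mathbb{R}^2/(\mathbb{Z}\times N\mathbb{Z})$, represented by $[0,1]\times[0,N]$, and integrals over $\mathbb{T}_N^2$ are over $x\in[0,1]$, $\xi\in[0,N]$. $\|\cdot\|_2$ is the $L^2(\mathbb{R})$ norm. *)

theory Defs
  imports "HOL-Analysis.Analysis"
begin

definition translation :: "real \<Rightarrow> (real \<Rightarrow> complex) \<Rightarrow> real \<Rightarrow> complex" where
  "translation x f = (\<lambda>t. f (t - x))"

definition modulation :: "real \<Rightarrow> (real \<Rightarrow> complex) \<Rightarrow> real \<Rightarrow> complex" where
  "modulation \<xi> f = (\<lambda>t. cis (2 * pi * \<xi> * t) * f t)"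

definition tf_shift :: "real \<Rightarrow> real \<Rightarrow> (real \<Rightarrow> complex) \<Rightarrow> real \<Rightarrow> complex" where
  "tf_shift x \<xi> f = modulation \<xi> (translation x f)"

definition L2_fun :: "(real \<Rightarrow> complex) set" where
  "L2_fun = {f \<in> borel_measurable lborel. integrable lborel (\<lambda>t. (cmod (f t))\<^sup>2)}"

definition L2_inner :: "(real \<Rightarrow> complex) \<Rightarrow> (real \<Rightarrow> complex) \<Rightarrow> complex" where
  "L2_inner f g = (LINT t|lborel. f t * cnj (g t))"

definition L2_norm :: "(real \<Rightarrow> complex) \<Rightarrow> real" where
  "L2_norm f = sqrt (LINT t|lborel. (cmod (f t))\<^sup>2)"

definition stft :: "(real \<Rightarrow> complex) \<Rightarrow> (real \<Rightarrow> complex) \<Rightarrow> real \<Rightarrow> real \<Rightarrow> complex" where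
  "stft g f x \<xi> = L2_inner f (tf_shift x \<xi> g)"

definition gauss :: "real \<Rightarrow> complex" where
  "gauss t = complex_of_real (exp (- pi * t\<^sup>2))"

text \<open>Every almost-everywhere class in the Feichtinger algebra has exactly one continuous
  representative; point evaluations refer to it.  The algebra is therefore modelled as
  the set of these representatives, so that equality of functions is equality of classes.\<close>

definition feichtinger :: "(real \<Rightarrow> complex) set" where
  "feichtinger = {f \<in> L2_fun. continuous_on UNIV f \<and>
     integrable lborel (\<lambda>(x, \<xi>). stft gauss f x \<xi>)}"

text \<open>An element of the dual space is represented by the antilinear functional
  \<open>h \<mapsto> \<langle>\<phi>, h\<rangle>\<close> on \<open>feichtinger\<close>, extended by \<open>0\<close> to all other functions.  Hence equality
  of such functionals is equality in the dual space, and weak-* sums are computed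
  pointwise in \<open>h\<close>.\<close>

type_synonym functional = "(real \<Rightarrow> complex) \<Rightarrow> complex"

definition delta :: "real \<Rightarrow> functional" where
  "delta t h = (if h \<in> feichtinger then cnj (h t) else 0)"

definition functional_of :: "(real \<Rightarrow> complex) \<Rightarrow> functional" where
  "functional_of f h = (if h \<in> feichtinger then L2_inner f h else 0)"

definition stft_dual :: "(real \<Rightarrow> complex) \<Rightarrow> functional \<Rightarrow> real \<Rightarrow> real \<Rightarrow> complex" where
  "stft_dual g \<phi> x \<xi> = \<phi> (tf_shift x \<xi> g)"

definition delta_train :: "nat \<Rightarrow> nat \<Rightarrow> functional" where
  "delta_train N n h = (\<Sum>\<^sub>\<infinity>k::int. delta (real n / real N + of_int k) h)"

definition delta_train_span :: "nat \<Rightarrow> functional set" where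
  "delta_train_span N = {\<phi>. \<exists>c :: nat \<Rightarrow> complex. \<phi> = (\<lambda>h. \<Sum>n<N. c n * delta_train N n h)}"

definition double_periodization :: "nat \<Rightarrow> (real \<Rightarrow> complex) \<Rightarrow> functional" where
  "double_periodization N f h =
     (\<Sum>\<^sub>\<infinity>(k\<^sub>1, k\<^sub>2) \<in> (UNIV :: (int \<times> int) set).
        functional_of (modulation (real N * of_int k\<^sub>2) (translation (of_int k\<^sub>1) f)) h)"

definition zak :: "(real \<Rightarrow> complex) \<Rightarrow> real \<Rightarrow> real \<Rightarrow> complex" where
  "zak f x \<xi> = (\<Sum>\<^sub>\<infinity>k::int. f (x - of_int k) * cis (2 * pi * of_int k * \<xi>))"

definition torus :: "nat \<Rightarrow> (real \<times> real) set" where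
  "torus N = {0..1} \<times> {0..real N}"

end

theory Submission
  imports Defs "HOL-Probability.Characteristic_Functions" "HOL-Real_Asymp.Real_Asymp"
begin

text \<open>
  Both formulas come down to one orthogonality relation on the torus.  Write
  \<open>y\<^sub>n = n / N\<close> and let \<open>Z\<^sub>n(x, \<xi>) = \<Sum>k. (\<pi>(x, \<xi>) g)(y\<^sub>n + k)\<close> be the periodization of the shifted
  window, sampled at \<open>y\<^sub>n\<close>.  Up to the factor \<open>e\<^sup>2\<^sup>\<pi>\<^sup>i\<^sup>\<xi>\<^sup>n\<^sup>/\<^sup>N\<close> this is the Zak transform in the
  statement (\<open>zak_eq_periodization\<close>), and its conjugate is the short-time Fourier transform of the
  delta train \<open>\<epsilon>\<^sub>n\<close>.  Expanding \<open>Z\<^sub>m\<close> and \<open>Z\<^sub>n\<close> into their series and integrating term by term, the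
  \<open>\<xi>\<close>-integral over \<open>[0, N]\<close> kills every term except those in which the sampling points
  \<open>y\<^sub>m + k\<close> and \<open>y\<^sub>n + l\<close> coincide; the \<open>x\<close>-integrals of the survivors tile the line and add up to
  \<open>N \<parallel>g\<parallel>\<^sup>2\<close>.  Hence the \<open>Z\<^sub>n\<close> are orthogonal with equal norms (\<open>periodization_orthogonality\<close>), and
  integrating \<open>V\<^sub>g \<phi>\<close> against \<open>Z\<^sub>n\<close> reads off the \<open>n\<close>-th coefficient of \<open>\<phi> \<in> S\<^sub>N\<close>.  This is the first
  formula.

  For the second formula, \<open>\<Sigma>\<^sub>N f\<close> is itself in \<open>S\<^sub>N\<close>: summing over the modulations by multiples
  of \<open>N\<close> is Poisson summation, which replaces the pairing by samples on \<open>(1/N)\<int>\<close>, and summing over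
  the integer translations then periodizes \<open>f\<close> (\<open>double_periodization_eq\<close>).  With the coefficients
  of \<open>\<Sigma>\<^sub>N f\<close> and of \<open>\<Sigma>\<^sub>N (\<pi>(x, \<xi>) g)\<close> known, the orthogonality relation applies again.

  What remains is analysis in the Feichtinger algebra, and it all rests on the Fourier inversion
  theorem applied to \<open>t \<mapsto> f(t) h\<^sub>0(t - x)\<close> for almost every \<open>x\<close>, where \<open>h\<^sub>0\<close> is the Gaussian.
  Evaluated crudely, it bounds \<open>f\<close> on each unit interval by an integral of \<open>V f\<close> over a strip, so the local
  suprema of \<open>f\<close> are summable (\<open>feichtinger_amalgam\<close>); this justifies the interchanges above.
  Integrated against \<open>h\<^sub>0\<close>, it gives a Moyal identity (\<open>feichtinger_moyal\<close>).  Using that identity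
  twice, first against the Gaussian and then against a second element of the algebra, shows that
  \<open>\<langle>f, \<pi>(\<lambda>) h\<rangle>\<close> is absolutely summable over the lattice \<open>\<int>\<^sup>2\<close> (\<open>feichtinger_lattice_summable\<close>), which
  is what makes the double series for \<open>\<Sigma>\<^sub>N f\<close> converge and Poisson summation hold at every point.
\<close>

section \<open>Gaussian integrals and Fourier inversion\<close>

text \<open>
  The substitution \<open>x = sqrt (2 \<pi>) a t\<close> turns the integrand into the standard normal density, whose
  characteristic function is known.
\<close>
lemma
  fixes a \<xi> :: real
  assumes "a > 0"
  shows integrable_gaussian: "integrable lborel (\<lambda>t. exp (- pi * (a * t)\<^sup>2))"
    and integral_gaussian: "(LINT t|lborel. exp (- pi * (a * t)\<^sup>2)) = 1 / a"
    and fourier_gaussian: "(LINT t|lborel. cis (2 * pi * \<xi> * t) * complex_of_real (exp (- pi * (a * t)\<^sup>2)))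
           = complex_of_real (exp (- pi * (\<xi> / a)\<^sup>2) / a)"
proof -
  define b where "b = sqrt (2 * pi) * a"
  have b: "b > 0" "b \<noteq> 0" using assms by (auto simp: b_def)
  have dens: "std_normal_density (0 + b * t) = exp (- pi * (a * t)\<^sup>2) / sqrt (2 * pi)" for t
    by (simp add: std_normal_density_def b_def power_mult_distrib real_sqrt_mult field_simps)
  have "integrable lborel (\<lambda>t. sqrt (2 * pi) * std_normal_density (0 + b * t))"
    by (intro integrable_mult_right lborel_integrable_real_affine integrable_normal_density b) simp
  then show "integrable lborel (\<lambda>t. exp (- pi * (a * t)\<^sup>2))"
    unfolding dens by simp
  have F: "(LINT t|lborel. cis (2 * pi * \<xi> * t) * complex_of_real (exp (- pi * (a * t)\<^sup>2)))
           = complex_of_real (exp (- pi * (\<xi> / a)\<^sup>2) / a)" for \<xi>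
  proof -
    define s where "s = sqrt (2 * pi) * \<xi> / a"
    have "complex_of_real (exp (- (s\<^sup>2) / 2)) = char std_normal_distribution s"
      by (simp add: char_std_normal_distribution)
    also have "\<dots> = (LINT x|lborel. std_normal_density x *\<^sub>R iexp (s * x))"
      unfolding char_def by (subst integral_density) auto
    also have "\<dots> = \<bar>b\<bar> *\<^sub>R (LINT t|lborel. std_normal_density (0 + b * t) *\<^sub>R iexp (s * (0 + b * t)))"
      by (rule lborel_integral_real_affine) (use b in simp)
    also have "(\<lambda>t. std_normal_density (0 + b * t) *\<^sub>R iexp (s * (0 + b * t))) =
      (\<lambda>t. complex_of_real (1 / sqrt (2 * pi)) * (cis (2 * pi * \<xi> * t) * complex_of_real (exp (- pi * (a * t)\<^sup>2))))"
    proof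
      fix t
      have "s * (0 + b * t) = 2 * pi * \<xi> * t"
        using assms by (simp add: s_def b_def)
      then have "iexp (s * (0 + b * t)) = cis (2 * pi * \<xi> * t)"
        unfolding cis_conv_exp by metis
      then show "std_normal_density (0 + b * t) *\<^sub>R iexp (s * (0 + b * t)) = 
         complex_of_real (1 / sqrt (2 * pi)) * (cis (2 * pi * \<xi> * t) * complex_of_real (exp (- pi * (a * t)\<^sup>2)))"
        unfolding dens by (simp add: scaleR_conv_of_real)
    qed
    also have "- (s\<^sup>2) / 2 = - pi * (\<xi> / a)\<^sup>2"
      by (simp add: s_def power_divide power_mult_distrib)
    finally show ?thesis
      using b assms unfolding integral_mult_right_zero
      by (simp add: scaleR_conv_of_real b_def field_simps)
  qed
  show "(LINT t|lborel. cis (2 * pi * \<xi> * t) * complex_of_real (exp (- pi * (a * t)\<^sup>2)))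
           = complex_of_real (exp (- pi * (\<xi> / a)\<^sup>2) / a)" by (rule F)
  from F[of 0] have "complex_of_real (LINT t|lborel. exp (- pi * (a * t)\<^sup>2)) = complex_of_real (1 / a)"
    by (simp flip: integral_complex_of_real)
  then show "(LINT t|lborel. exp (- pi * (a * t)\<^sup>2)) = 1 / a"
    unfolding of_real_eq_iff .
qed

lemma integrable_tensor_product:
  fixes u :: "'a :: euclidean_space \<Rightarrow> complex" and v :: "'b :: euclidean_space \<Rightarrow> complex"
  assumes u: "integrable lborel u" and v: "integrable lborel v"
  shows "integrable (lborel \<Otimes>\<^sub>M lborel) (\<lambda>(x, y). u x * v y)"
proof -
  have [measurable]: "u \<in> borel_measurable lborel" "v \<in> borel_measurable lborel"
    using u v by auto
  show ?thesis
  proof (rule lborel_pair.Fubini_integrable)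
    show "(\<lambda>(x, y). u x * v y) \<in> borel_measurable (lborel \<Otimes>\<^sub>M lborel)"
      by measurable
    show "integrable lborel (\<lambda>x. LINT y|lborel. norm (case (x, y) of (x, y) \<Rightarrow> u x * v y))"
      using u by (simp add: norm_mult)
    show "AE x in lborel. integrable lborel (\<lambda>y. case (x, y) of (x, y) \<Rightarrow> u x * v y)"
      using v by simp
  qed
qed

text \<open>
  The function \<open>F\<close> is integrable but possibly unbounded away from \<open>t\<close>, so dominated convergence after
  rescaling is not available.  Away from \<open>t\<close> the kernel itself is uniformly small, which needs only
  the integrability of \<open>F\<close>; near \<open>t\<close> continuity suffices.
\<close>
lemma gaussian_approximate_identity:
  fixes F :: "real \<Rightarrow> complex"
  assumes cont: "continuous_on UNIV F" and F: "integrable lborel F"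
  shows "(\<lambda>n. LINT s|lborel. F s * complex_of_real (real (Suc n) * exp (- pi * (real (Suc n) * (t - s))\<^sup>2)))
           \<longlonglongrightarrow> F t"
proof -
  define K where "K n s = real (Suc n) * exp (- pi * (real (Suc n) * (t - s))\<^sup>2)" for n s
  define E where "E s = exp (- pi * (sqrt (1 / 2) * (t - s))\<^sup>2)" for s
  have shift: "integrable lborel (\<lambda>s. h (t - s))" "(LINT s|lborel. h (t - s)) = (LINT s|lborel. h s)"
    if "integrable lborel h" for h :: "real \<Rightarrow> real"
    using lborel_integrable_real_affine[OF that, of "-1" t] lborel_integral_real_affine[of "-1" h t] by auto
  have K: "integrable lborel (K n)" "(LINT s|lborel. K n s) = 1" for n
    using shift[OF integrable_gaussian[of "real (Suc n)"]] integral_gaussian[of "real (Suc n)"]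
    unfolding K_def by auto
  have E: "integrable lborel E"
    using shift[OF integrable_gaussian[of "sqrt (1/2)"]] unfolding E_def by simp
  have [measurable]: "F \<in> borel_measurable lborel" using F by auto
  have Kbound: "K n s \<le> real (Suc n)" "K n s \<ge> 0" for n s
    unfolding K_def by auto
  have FK: "integrable lborel (\<lambda>s. F s * complex_of_real (K n s))" for n
  proof (rule Bochner_Integration.integrable_bound)
    show "integrable lborel (\<lambda>s. real (Suc n) * norm (F s))" using F by simp
    show "(\<lambda>s. F s * complex_of_real (K n s)) \<in> borel_measurable lborel"
      unfolding K_def by measurable
    show "AE s in lborel. norm (F s * complex_of_real (K n s)) \<le> norm (real (Suc n) * norm (F s))"
      using mult_right_mono[OF Kbound(1)[of n] norm_ge_zero[of "F _"]] Kbound(2)[of n]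
      by (intro AE_I2) (simp add: norm_mult mult.commute)
  qed
  have "(\<lambda>n. LINT s|lborel. F s * complex_of_real (K n s)) \<longlonglongrightarrow> F t"
  proof (rule LIMSEQ_I)
    fix r :: real assume "r > 0"
    define e where "e = r / 2"
    have e: "e > 0" using \<open>r > 0\<close> by (simp add: e_def)
    from cont have "isCont F t" by (simp add: continuous_on_eq_continuous_at)
    then obtain \<delta> where \<delta>: "\<delta> > 0" "\<And>s. \<bar>s - t\<bar> < \<delta> \<Longrightarrow> norm (F s - F t) < e"
      using e unfolding continuous_at_eps_delta dist_norm real_norm_def by blast
    \<comment> \<open>Half of the exponent gives the decay in \<open>n\<close>; the other half, \<open>E\<close>, keeps the contribution of the constant \<open>F t\<close> integrable.\<close>
    define q where "q n = real (Suc n) * exp (- pi * (real (Suc n))\<^sup>2 * \<delta>\<^sup>2 / 2)" for n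
    have q0: "q n \<ge> 0" for n by (simp add: q_def)
    have point: "norm ((F s - F t) * complex_of_real (K n s))
        \<le> e * K n s + q n * norm (F s) + q n * norm (F t) * E s" for n s
    proof (cases "\<bar>s - t\<bar> < \<delta>")
      case True
      have "norm ((F s - F t) * complex_of_real (K n s)) \<le> e * K n s"
        using \<delta>(2)[OF True] Kbound(2)[of n s] by (auto simp: norm_mult intro!: mult_right_mono)
      then show ?thesis using q0[of n] by (smt (verit) E_def exp_ge_zero mult_nonneg_nonneg norm_ge_zero)
    next
      case False
      define u where "u = t - s"
      have u: "\<delta>\<^sup>2 \<le> u\<^sup>2" using False \<delta>(1) unfolding u_def
        by (auto simp: abs_le_square_iff[symmetric])
      let ?m = "real (Suc n)"
      have m: "?m\<^sup>2 \<ge> 1" by (intro one_le_power) simp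
      have "?m\<^sup>2 * \<delta>\<^sup>2 \<le> ?m\<^sup>2 * u\<^sup>2" by (intro mult_left_mono u) simp
      moreover have "u\<^sup>2 \<le> ?m\<^sup>2 * u\<^sup>2" using mult_right_mono[OF m, of "u\<^sup>2"] by simp
      ultimately have "?m\<^sup>2 * \<delta>\<^sup>2 / 2 + u\<^sup>2 / 2 \<le> (?m * u)\<^sup>2" unfolding power_mult_distrib by linarith
      then have "pi * (?m\<^sup>2 * \<delta>\<^sup>2 / 2 + u\<^sup>2 / 2) \<le> pi * (?m * u)\<^sup>2"
        by (intro mult_left_mono) auto
      then have "exp (- pi * (?m * u)\<^sup>2) \<le> exp (- pi * ?m\<^sup>2 * \<delta>\<^sup>2 / 2 + - pi * (sqrt (1/2) * u)\<^sup>2)"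
        by (subst exp_le_cancel_iff) (simp add: power_mult_distrib distrib_left real_sqrt_pow2 power_divide mult.assoc)
      then have K1: "K n s \<le> q n * E s"
        unfolding K_def q_def E_def u_def[symmetric] exp_add mult.assoc
        by (intro mult_left_mono) auto
      have "E s \<le> 1" unfolding E_def by simp
      then have K2: "K n s \<le> q n" using K1 q0[of n] by (meson mult_left_le order_trans)
      have "norm ((F s - F t) * complex_of_real (K n s)) \<le> (norm (F s) + norm (F t)) * K n s"
        using Kbound(2)[of n s] by (simp add: norm_mult mult_right_mono norm_triangle_ineq4)
      also have "\<dots> \<le> norm (F s) * q n + norm (F t) * (q n * E s)"
        unfolding distrib_right by (intro add_mono mult_left_mono K1 K2) auto
      finally show ?thesis using e Kbound(2)[of n s] by (smt (verit) mult.commute mult.left_commute mult_nonneg_nonneg)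
    qed
    have est: "norm ((LINT s|lborel. F s * complex_of_real (K n s)) - F t)
       \<le> e + q n * ((LINT s|lborel. norm (F s)) + norm (F t) * (LINT s|lborel. E s))" for n
    proof -
      have KC: "integrable lborel (\<lambda>s. complex_of_real (K n s))" using K(1)[of n] by simp
      have "(LINT s|lborel. F t * complex_of_real (K n s)) = F t"
        using K(2)[of n] by simp
      then have "(LINT s|lborel. F s * complex_of_real (K n s)) - F t = 
         (LINT s|lborel. F s * complex_of_real (K n s)) - (LINT s|lborel. F t * complex_of_real (K n s))" by simp
      also have "\<dots> = (LINT s|lborel. (F s - F t) * complex_of_real (K n s))"
        unfolding left_diff_distrib
        by (rule Bochner_Integration.integral_diff[symmetric]) (use FK KC in auto)
      also have "norm \<dots> \<le> (LINT s|lborel. e * K n s + q n * norm (F s) + q n * norm (F t) * E s)"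
      proof (rule Bochner_Integration.integral_norm_bound_integral)
        show "integrable lborel (\<lambda>s. (F s - F t) * complex_of_real (K n s))"
          unfolding left_diff_distrib by (intro Bochner_Integration.integrable_diff FK integrable_mult_right KC)
      qed (use K E F point in auto)
      also have "\<dots> = e + q n * (LINT s|lborel. norm (F s)) + q n * norm (F t) * (LINT s|lborel. E s)"
        using K E F by simp
      finally show ?thesis by (simp add: algebra_simps)
    qed
    have "q \<longlonglongrightarrow> 0" unfolding q_def using \<delta>(1) by real_asymp
    then have "(\<lambda>n. q n * ((LINT s|lborel. norm (F s)) + norm (F t) * (LINT s|lborel. E s))) \<longlonglongrightarrow> 0"
      by (rule tendsto_mult_left_zero)
    then have "\<forall>\<^sub>F n in sequentially. q n * ((LINT s|lborel. norm (F s)) + norm (F t) * (LINT s|lborel. E s)) < e"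
      using e by (rule order_tendstoD)
    then show "\<exists>no. \<forall>n\<ge>no. norm ((LINT s|lborel. F s * complex_of_real (K n s)) - F t) < r"
      unfolding eventually_sequentially using est e_def by (smt (verit) field_sum_of_halves)
  qed
  then show ?thesis unfolding K_def .
qed

lemma cis_borel_measurable [measurable]: "cis \<in> borel_measurable borel"
  by (intro borel_measurable_continuous_onI continuous_intros)

text \<open>
  Damping the inverse integral by a wide Gaussian allows Fubini, and turns it into the convolution
  of \<open>F\<close> with an approximate identity.  Continuity of \<open>F\<close> gives the identity at every point rather
  than almost everywhere.
\<close>
lemma fourier_inversion:
  fixes F G :: "real \<Rightarrow> complex"
  assumes cont: "continuous_on UNIV F" and F: "integrable lborel F"
    and G_def: "\<And>\<xi>. G \<xi> = (LINT s|lborel. F s * cis (- (2 * pi * \<xi> * s)))"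
    and G: "integrable lborel G"
  shows "F t = (LINT \<xi>|lborel. G \<xi> * cis (2 * pi * \<xi> * t))"
proof -
  define w where "w n \<xi> = complex_of_real (exp (- pi * ((1 / real (Suc n)) * \<xi>)\<^sup>2))" for n \<xi>
  have [measurable]: "F \<in> borel_measurable lborel" "G \<in> borel_measurable lborel"
    "w n \<in> borel_measurable lborel" for n
    using F G unfolding w_def by auto
  have "(\<lambda>n. LINT \<xi>|lborel. G \<xi> * cis (2 * pi * \<xi> * t) * w n \<xi>) \<longlonglongrightarrow>
        (LINT \<xi>|lborel. G \<xi> * cis (2 * pi * \<xi> * t))"
  proof (rule integral_dominated_convergence)
    show "integrable lborel (\<lambda>\<xi>. norm (G \<xi>))" using G by simp
    show "AE \<xi> in lborel. norm (G \<xi> * cis (2 * pi * \<xi> * t) * w n \<xi>) \<le> norm (G \<xi>)" for n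
      by (intro AE_I2) (simp add: norm_mult w_def mult_left_le)
    show "AE \<xi> in lborel. (\<lambda>n. G \<xi> * cis (2 * pi * \<xi> * t) * w n \<xi>) \<longlonglongrightarrow> G \<xi> * cis (2 * pi * \<xi> * t)"
    proof (intro AE_I2)
      fix \<xi>
      have "(\<lambda>n. 1 / real (Suc n)) \<longlonglongrightarrow> 0" by real_asymp
      then have "(\<lambda>n. exp (- pi * ((1 / real (Suc n)) * \<xi>)\<^sup>2)) \<longlonglongrightarrow> exp (- pi * (0 * \<xi>)\<^sup>2)"
        by (intro tendsto_intros)
      then have "(\<lambda>n. exp (- pi * ((1 / real (Suc n)) * \<xi>)\<^sup>2)) \<longlonglongrightarrow> 1" by simp
      from tendsto_of_real[OF this] have "(\<lambda>n. w n \<xi>) \<longlonglongrightarrow> 1" unfolding w_def by simp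
      from tendsto_mult[OF tendsto_const this]
      show "(\<lambda>n. G \<xi> * cis (2 * pi * \<xi> * t) * w n \<xi>) \<longlonglongrightarrow> G \<xi> * cis (2 * pi * \<xi> * t)" by simp
    qed
  qed measurable
  moreover have "(LINT \<xi>|lborel. G \<xi> * cis (2 * pi * \<xi> * t) * w n \<xi>) = 
     (LINT s|lborel. F s * complex_of_real (real (Suc n) * exp (- pi * (real (Suc n) * (t - s))\<^sup>2)))" for n
  proof -
    have wint: "integrable lborel (w n)"
      unfolding w_def using integrable_gaussian[of "1 / real (Suc n)"] by simp
    have *: "integrable (lborel \<Otimes>\<^sub>M lborel) (\<lambda>(s, \<xi>). F s * w n \<xi> * cis (2 * pi * \<xi> * (t - s)))"
    proof (rule Bochner_Integration.integrable_bound)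
      show "integrable (lborel \<Otimes>\<^sub>M lborel) (\<lambda>(s, \<xi>). F s * w n \<xi>)"
        by (rule integrable_tensor_product[OF F wint])
    qed (measurable, auto simp: norm_mult)
    have "(LINT \<xi>|lborel. G \<xi> * cis (2 * pi * \<xi> * t) * w n \<xi>) =
       (LINT \<xi>|lborel. LINT s|lborel. F s * w n \<xi> * cis (2 * pi * \<xi> * (t - s)))"
    proof (rule Bochner_Integration.integral_cong[OF refl])
      fix \<xi>
      have eq: "F s * w n \<xi> * cis (2 * pi * \<xi> * (t - s)) =
          (F s * cis (- (2 * pi * \<xi> * s))) * (cis (2 * pi * \<xi> * t) * w n \<xi>)" for s
        by (simp add: mult_ac cis_mult algebra_simps)
      show "G \<xi> * cis (2 * pi * \<xi> * t) * w n \<xi> = (LINT s|lborel. F s * w n \<xi> * cis (2 * pi * \<xi> * (t - s)))"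
        unfolding eq G_def integral_mult_left_zero by (simp add: mult.assoc)
    qed
    also have "\<dots> = (LINT s|lborel. LINT \<xi>|lborel. F s * w n \<xi> * cis (2 * pi * \<xi> * (t - s)))"
      by (rule lborel_pair.Fubini_integral) (use * in simp)
    also have "\<dots> = (LINT s|lborel. F s * complex_of_real (real (Suc n) * exp (- pi * (real (Suc n) * (t - s))\<^sup>2)))"
    proof (rule Bochner_Integration.integral_cong[OF refl])
      fix s
      have "(LINT \<xi>|lborel. F s * w n \<xi> * cis (2 * pi * \<xi> * (t - s))) =
         F s * (LINT \<xi>|lborel. cis (2 * pi * (t - s) * \<xi>) * complex_of_real (exp (- pi * ((1 / real (Suc n)) * \<xi>)\<^sup>2)))"
        by (simp add: w_def mult_ac flip: integral_mult_right_zero)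
      also have "\<dots> = F s * complex_of_real (real (Suc n) * exp (- pi * (real (Suc n) * (t - s))\<^sup>2))"
        by (subst fourier_gaussian) (simp_all add: mult_ac)
      finally show "(LINT \<xi>|lborel. F s * w n \<xi> * cis (2 * pi * \<xi> * (t - s))) = \<dots>" .
    qed
    finally show ?thesis .
  qed
  ultimately show ?thesis
    using gaussian_approximate_identity[OF cont F, of t] LIMSEQ_unique by auto
qed

section \<open>Short-time Fourier transforms in the Feichtinger algebra\<close>

lemma gauss_measurable [measurable]: "gauss \<in> borel_measurable borel"
  unfolding gauss_def by measurable

lemma cnj_borel_measurable [measurable]: "cnj \<in> borel_measurable borel"
  by (intro borel_measurable_continuous_onI continuous_intros)

lemma norm_gauss_le_1: "norm (gauss t) \<le> 1"
  by (simp add: gauss_def)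

lemma continuous_on_gauss [continuous_intros]:
  "continuous_on A h \<Longrightarrow> continuous_on A (\<lambda>t. gauss (h t))"
  unfolding gauss_def by (intro continuous_intros)

lemma stft_gauss_eq:
  "stft gauss f x \<xi> = (LINT t|lborel. f t * gauss (t - x) * cis (- (2 * pi * \<xi> * t)))"
  by (simp add: stft_def L2_inner_def tf_shift_def modulation_def translation_def gauss_def
      cis_cnj mult_ac)

lemma stft_tf_shift:
  "stft w (tf_shift a b f) x \<xi> = cis (2 * pi * (b - \<xi>) * a) * stft w f (x - a) (\<xi> - b)"
proof -
  have "stft w (tf_shift a b f) x \<xi> =
     (LINT t|lborel. cis (2 * pi * b * t) * f (t - a) * (cis (- (2 * pi * \<xi> * t)) * cnj (w (t - x))))"
    by (simp add: stft_def L2_inner_def tf_shift_def modulation_def translation_def cis_cnj)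
  also have "\<dots> = (LINT t|lborel. cis (2 * pi * b * (a + 1 * t)) * f ((a + 1 * t) - a) * (cis (- (2 * pi * \<xi> * (a + 1 * t))) * cnj (w ((a + 1 * t) - x))))"
    by (subst lborel_integral_real_affine[of 1 _ a]) simp_all
  also have "\<dots> = (LINT t|lborel. cis (2 * pi * (b - \<xi>) * a) * (f t * (cis (- (2 * pi * (\<xi> - b) * t)) * cnj (w (t - (x - a))))))"
  proof (rule Bochner_Integration.integral_cong[OF refl])
    fix t
    have "cis (2 * pi * b * (a + 1 * t)) * cis (- (2 * pi * \<xi> * (a + 1 * t))) =
       cis (2 * pi * (b - \<xi>) * a) * cis (- (2 * pi * (\<xi> - b) * t))"
      by (simp add: cis_mult algebra_simps)
    then show "cis (2 * pi * b * (a + 1 * t)) * f ((a + 1 * t) - a) * (cis (- (2 * pi * \<xi> * (a + 1 * t))) * cnj (w ((a + 1 * t) - x)))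
      = cis (2 * pi * (b - \<xi>) * a) * (f t * (cis (- (2 * pi * (\<xi> - b) * t)) * cnj (w (t - (x - a)))))"
      by (simp add: algebra_simps)
  qed
  finally show ?thesis
    by (simp add: stft_def L2_inner_def tf_shift_def modulation_def translation_def cis_cnj)
qed

lemma norm_stft_tf_shift: "norm (stft w (tf_shift a b f) x \<xi>) = norm (stft w f (x - a) (\<xi> - b))"
  by (simp add: stft_tf_shift norm_mult)

lemma norm_L2_inner_commute: "norm (L2_inner u v) = norm (L2_inner v u)"
proof -
  have "L2_inner v u = cnj (L2_inner u v)"
    unfolding L2_inner_def by (subst Bochner_Integration.integral_cnj[symmetric]) (simp add: mult.commute)
  then show ?thesis by simp
qed

lemma feichtingerD:
  assumes "f \<in> feichtinger"
  shows "f \<in> borel_measurable borel" "integrable lborel (\<lambda>t. (cmod (f t))\<^sup>2)"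
    "continuous_on UNIV f" "integrable lborel (\<lambda>(x, \<xi>). stft gauss f x \<xi>)"
  using assms by (auto simp: feichtinger_def L2_fun_def)

text \<open>
  By covariance the short-time Fourier transform of a shifted function is a translate of the
  original one, up to a unimodular factor.
\<close>
lemma tf_shift_in_feichtinger:
  assumes f: "f \<in> feichtinger"
  shows "tf_shift a b f \<in> feichtinger"
proof -
  note F = feichtingerD[OF f]
  have [measurable]: "f \<in> borel_measurable borel" by (rule F)
  have cont: "continuous_on UNIV (tf_shift a b f)"
    unfolding tf_shift_def modulation_def translation_def
    by (intro continuous_intros continuous_on_compose2[OF F(3)]) auto
  have sq: "integrable lborel (\<lambda>t. (cmod (tf_shift a b f t))\<^sup>2)"
    using lborel_integrable_real_affine[OF F(2), of 1 "-a"]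
    by (simp add: tf_shift_def modulation_def translation_def norm_mult add.commute)
  have shift: "integrable lborel (\<lambda>p. case_prod (stft gauss f) ((-a, -b) + p))"
  proof -
    have "integrable (distr lborel borel ((+) (-a, -b))) (case_prod (stft gauss f))"
      unfolding lborel_distr_plus by (rule F)
    then show ?thesis
      by (subst (asm) integrable_distr_eq) (use borel_measurable_integrable[OF F(4)] in auto)
  qed
  have "integrable lborel (\<lambda>p. cis (2 * pi * (b - snd p) * a) * case_prod (stft gauss f) ((-a, -b) + p))"
  proof (rule Bochner_Integration.integrable_bound[OF shift])
    have "(\<lambda>p :: real \<times> real. cis (2 * pi * (b - snd p) * a)) \<in> borel_measurable borel"
      by (intro borel_measurable_continuous_onI continuous_intros)
    moreover have "(\<lambda>p. case_prod (stft gauss f) ((-a, -b) + p)) \<in> borel_measurable lborel"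
      using shift by (rule borel_measurable_integrable)
    ultimately
    show "(\<lambda>p. cis (2 * pi * (b - snd p) * a) * case_prod (stft gauss f) ((-a, -b) + p)) \<in> borel_measurable lborel"
      by (intro borel_measurable_times) simp_all
  qed (simp add: norm_mult)
  also have "(\<lambda>p. cis (2 * pi * (b - snd p) * a) * case_prod (stft gauss f) ((-a, -b) + p)) =
      (\<lambda>(x, \<xi>). stft gauss (tf_shift a b f) x \<xi>)"
    by (auto simp: fun_eq_iff stft_tf_shift)
  finally have V: "integrable lborel (\<lambda>(x, \<xi>). stft gauss (tf_shift a b f) x \<xi>)" .
  have "tf_shift a b f \<in> borel_measurable lborel"
    using cont by (simp add: borel_measurable_continuous_onI)
  with cont sq V show ?thesis by (simp add: feichtinger_def L2_fun_def)
qed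

lemma integrable_gauss_shift_power2: "integrable lborel (\<lambda>t. (cmod (gauss (t - x)))\<^sup>2)"
  and integral_gauss_shift_power2: "(LINT t|lborel. (cmod (gauss (t - x)))\<^sup>2) = 1 / sqrt 2"
proof -
  have eq: "(cmod (gauss (t - x)))\<^sup>2 = exp (- pi * (sqrt 2 * (- x + 1 * t))\<^sup>2)" for t
    by (simp add: gauss_def power_mult_distrib flip: exp_double)
  have "integrable lborel (\<lambda>t. exp (- pi * (sqrt 2 * t)\<^sup>2))"
    by (rule integrable_gaussian) simp
  from lborel_integrable_real_affine[OF this, of 1 "-x"]
  show "integrable lborel (\<lambda>t. (cmod (gauss (t - x)))\<^sup>2)" unfolding eq by simp
  show "(LINT t|lborel. (cmod (gauss (t - x)))\<^sup>2) = 1 / sqrt 2" unfolding eq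
    using lborel_integral_real_affine[of 1 "\<lambda>t. exp (- pi * (sqrt 2 * t)\<^sup>2)" "-x"]
     integral_gaussian[of "sqrt 2"] by simp
qed

lemma integrable_mult_L2:
  fixes u v :: "real \<Rightarrow> complex"
  assumes "u \<in> borel_measurable borel" "v \<in> borel_measurable borel"
    "integrable lborel (\<lambda>t. (cmod (u t))\<^sup>2)" "integrable lborel (\<lambda>t. (cmod (v t))\<^sup>2)"
  shows "integrable lborel (\<lambda>t. u t * v t)"
proof (rule Bochner_Integration.integrable_bound)
  show "integrable lborel (\<lambda>t. (cmod (u t))\<^sup>2 + (cmod (v t))\<^sup>2)" using assms by simp
  show "AE t in lborel. norm (u t * v t) \<le> norm ((cmod (u t))\<^sup>2 + (cmod (v t))\<^sup>2)"
  proof (intro AE_I2)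
    fix t
    have "2 * (cmod (u t) * cmod (v t)) \<le> (cmod (u t))\<^sup>2 + (cmod (v t))\<^sup>2"
      using sum_squares_bound[of "cmod (u t)" "cmod (v t)"] by simp
    moreover have "0 \<le> cmod (u t) * cmod (v t)" by simp
    ultimately show "norm (u t * v t) \<le> norm ((cmod (u t))\<^sup>2 + (cmod (v t))\<^sup>2)"
      unfolding norm_mult real_norm_def by linarith
  qed
qed (use assms in measurable)

text \<open>
  The exceptional set of \<open>x\<close> does not depend on \<open>t\<close>: by Fubini, almost every slice \<open>V f(x, \<cdot>)\<close> is
  integrable, and Fourier inversion then holds at all \<open>t\<close> simultaneously.
\<close>
lemma feichtinger_inversion_AE:
  assumes f: "f \<in> feichtinger"
  shows "AE x in lborel. integrable lborel (\<lambda>\<xi>. stft gauss f x \<xi>) \<and>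
    (\<forall>t. f t * gauss (t - x) = (LINT \<xi>|lborel. stft gauss f x \<xi> * cis (2 * pi * \<xi> * t)))"
proof -
  note F = feichtingerD[OF f]
  have "AE x in lborel. integrable lborel (\<lambda>\<xi>. stft gauss f x \<xi>)"
    using lborel_pair.AE_integrable_fst'[of "\<lambda>(x, \<xi>). stft gauss f x \<xi>"] F(4)
    by (simp add: lborel_prod)
  then show ?thesis
  proof eventually_elim
    case (elim x)
    have "f t * gauss (t - x) = (LINT \<xi>|lborel. stft gauss f x \<xi> * cis (2 * pi * \<xi> * t))" for t
    proof (rule fourier_inversion[of "\<lambda>t. f t * gauss (t - x)"])
      show "continuous_on UNIV (\<lambda>t. f t * gauss (t - x))"
        by (intro continuous_intros F)
      show "integrable lborel (\<lambda>t. f t * gauss (t - x))"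
        by (intro integrable_mult_L2 F integrable_gauss_shift_power2) measurable
    qed (use elim stft_gauss_eq in auto)
    with elim show ?case by blast
  qed
qed

lemma indicator_unit_interval:
  "indicator {real_of_int k..<real_of_int k + 1} x = (of_bool (\<lfloor>x\<rfloor> = k) :: real)"
  unfolding indicator_def by (intro arg_cong[where f=of_bool]) (auto simp: floor_eq_iff)

text \<open>
  Membership in the Wiener amalgam space of locally bounded functions with summable suprema over
  the intervals \<open>[k, k + 1)\<close>, with an explicit majorant.
\<close>
definition amalgam_bound :: "(int \<Rightarrow> real) \<Rightarrow> (real \<Rightarrow> complex) \<Rightarrow> bool" where
  "amalgam_bound B f \<longleftrightarrow> B summable_on UNIV \<and> (\<forall>t. norm (f t) \<le> B \<lfloor>t\<rfloor>)"

text \<open>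
  In \<open>f(t) h\<^sub>0(t - x) = \<integral> V f(x, \<xi>) e\<^sup>2\<^sup>\<pi>\<^sup>i\<^sup>\<xi>\<^sup>t d\<xi>\<close> the right-hand side is at most the \<open>L\<^sup>1\<close> norm of the
  slice at \<open>x\<close>, whatever \<open>t\<close> is.  Averaging over the \<open>x\<close> in the unit interval that contains \<open>t\<close>, where
  \<open>h\<^sub>0(t - x) \<ge> e\<^sup>-\<^sup>\<pi>\<close>, bounds \<open>f\<close> there by an integral of \<open>V f\<close> over a strip, and the strips are
  disjoint.
\<close>
lemma feichtinger_amalgam:
  assumes f: "f \<in> feichtinger"
  obtains B where "amalgam_bound B f"
proof -
  note F = feichtingerD[OF f]
  define G where "G x = (LINT \<xi>|lborel. norm (stft gauss f x \<xi>))" for x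
  have Gint: "integrable lborel G"
    unfolding G_def
    using lborel_pair.integrable_fst'[of "\<lambda>p. norm (case_prod (stft gauss f) p)"] F(4)
    by (simp add: lborel_prod)
  have G0: "G x \<ge> 0" for x unfolding G_def by (intro integral_nonneg_AE) auto
  have AEb: "AE x in lborel. \<forall>t. norm (f t) * exp (- pi * (t - x)\<^sup>2) \<le> G x"
    using feichtinger_inversion_AE[OF f]
  proof eventually_elim
    case (elim x)
    show ?case
    proof
      fix t
      have "norm (f t) * exp (- pi * (t - x)\<^sup>2) = norm (f t * gauss (t - x))"
        by (simp add: norm_mult gauss_def)
      also have "\<dots> = norm (LINT \<xi>|lborel. stft gauss f x \<xi> * cis (2 * pi * \<xi> * t))" using elim by simp
      also have "\<dots> \<le> (LINT \<xi>|lborel. norm (stft gauss f x \<xi> * cis (2 * pi * \<xi> * t)))"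
        by (rule integral_norm_bound)
      also have "\<dots> = G x" by (simp add: G_def norm_mult)
      finally show "norm (f t) * exp (- pi * (t - x)\<^sup>2) \<le> G x" .
    qed
  qed
  define J where "J k = (LINT x|lborel. G x * indicator {real_of_int k..<real_of_int k + 1} x)" for k :: int
  have Jint: "integrable lborel (\<lambda>x. G x * indicator {real_of_int k..<real_of_int k + 1} x)" for k :: int
    by (rule Bochner_Integration.integrable_bound[OF Gint]) (use Gint in \<open>auto simp: indicator_def\<close>)
  have J: "norm (f t) * exp (- pi) \<le> J \<lfloor>t\<rfloor>" for t
  proof -
    let ?I = "\<lambda>x. indicator {real_of_int \<lfloor>t\<rfloor>..<real_of_int \<lfloor>t\<rfloor> + 1} x :: real"
    have "norm (f t) * exp (- pi) = (LINT x|lborel. norm (f t) * exp (- pi) * ?I x)"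
      by simp
    also have "\<dots> \<le> J \<lfloor>t\<rfloor>" unfolding J_def
    proof (rule integral_mono_AE[OF _ Jint])
      show "AE x in lborel. norm (f t) * exp (- pi) * ?I x \<le> G x * ?I x"
        using AEb
      proof eventually_elim
        case (elim x)
        have "norm (f t) * exp (- pi) \<le> G x" if "\<lfloor>t\<rfloor> = \<lfloor>x\<rfloor>"
        proof -
          have "\<bar>t - x\<bar> \<le> 1" using that by linarith
          then have "(t - x)\<^sup>2 \<le> 1" by (simp add: abs_square_le_1)
          then have "exp (- pi) \<le> exp (- pi * (t - x)\<^sup>2)" by (simp add: mult_left_le)
          then show ?thesis using elim[rule_format, of t]
            by (meson mult_left_mono norm_ge_zero order_trans)
        qed
        then show ?case unfolding indicator_unit_interval by auto
      qed
    qed auto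
    finally show ?thesis .
  qed
  have "J summable_on UNIV"
  proof (rule nonneg_bdd_above_summable_on)
    show "0 \<le> J k" for k unfolding J_def using G0 by (intro integral_nonneg_AE) auto
    show "bdd_above (sum J ` {K. K \<subseteq> UNIV \<and> finite K})"
    proof (rule bdd_aboveI2)
      fix K :: "int set" assume "K \<in> {K. K \<subseteq> UNIV \<and> finite K}"
      then have K: "finite K" by simp
      have "sum J K = (LINT x|lborel. (\<Sum>k\<in>K. G x * indicator {real_of_int k..<real_of_int k + 1} x))"
        unfolding J_def by (rule Bochner_Integration.integral_sum[symmetric]) (rule Jint)
      also have "\<dots> \<le> (LINT x|lborel. G x)"
      proof (rule integral_mono[OF _ Gint])
        fix x
        have "(\<Sum>k\<in>K. G x * indicator {real_of_int k..<real_of_int k + 1} x) = G x * (\<Sum>k\<in>K. of_bool (\<lfloor>x\<rfloor> = k))"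
          unfolding indicator_unit_interval sum_distrib_left ..
        also have "\<dots> \<le> G x * 1"
          using K by (intro mult_left_mono G0) (simp add: of_bool_def)
        finally show "(\<Sum>k\<in>K. G x * indicator {real_of_int k..<real_of_int k + 1} x) \<le> G x"
          by simp
      qed (use Jint in auto)
      finally show "sum J K \<le> (LINT x|lborel. G x)" .
    qed
  qed
  then have "(\<lambda>k. exp pi * J k) summable_on UNIV" by (rule summable_on_cmult_right)
  moreover have "norm (f t) \<le> exp pi * J \<lfloor>t\<rfloor>" for t
    using mult_left_mono[OF J[of t], of "exp pi"] by (simp add: exp_minus field_simps)
  ultimately have "amalgam_bound (\<lambda>k. exp pi * J k) f"
    unfolding amalgam_bound_def by blast
  then show thesis by (rule that)
qed

text \<open>
  The pointwise inversion formula for the short-time Fourier transform: multiply the slicewise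
  inversion by \<open>h\<^sub>0(t - x)\<close> and integrate over \<open>x\<close>.  The constant is \<open>\<parallel>h\<^sub>0\<parallel>\<^sup>2 = 1 / sqrt 2\<close>.
\<close>
lemma feichtinger_reconstruction:
  assumes f: "f \<in> feichtinger"
  shows "f t / sqrt 2 = (LINT (x, \<xi>)|lborel. stft gauss f x \<xi> * (cis (2 * pi * \<xi> * t) * gauss (t - x)))"
proof -
  note F = feichtingerD[OF f]
  have I: "integrable (lborel \<Otimes>\<^sub>M lborel) (\<lambda>(x, \<xi>). stft gauss f x \<xi> * (cis (2 * pi * \<xi> * t) * gauss (t - x)))"
  proof (rule Bochner_Integration.integrable_bound)
    show V: "integrable (lborel \<Otimes>\<^sub>M lborel) (\<lambda>(x, \<xi>). stft gauss f x \<xi>)" using F(4) by (simp add: lborel_prod)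
    have [measurable]: "(\<lambda>(x, \<xi>). stft gauss f x \<xi>) \<in> borel_measurable (lborel \<Otimes>\<^sub>M lborel)"
      using V by (rule borel_measurable_integrable)
    show "(\<lambda>(x, \<xi>). stft gauss f x \<xi> * (cis (2 * pi * \<xi> * t) * gauss (t - x))) \<in> borel_measurable (lborel \<Otimes>\<^sub>M lborel)"
      by measurable
    show "AE p in lborel \<Otimes>\<^sub>M lborel. norm (case p of (x, \<xi>) \<Rightarrow> stft gauss f x \<xi> * (cis (2 * pi * \<xi> * t) * gauss (t - x)))
       \<le> norm (case p of (x, \<xi>) \<Rightarrow> stft gauss f x \<xi>)"
      using norm_gauss_le_1 by (intro AE_I2) (auto simp: norm_mult mult_left_le)
  qed
  have "(LINT (x, \<xi>)|lborel. stft gauss f x \<xi> * (cis (2 * pi * \<xi> * t) * gauss (t - x))) =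
    (LINT x|lborel. LINT \<xi>|lborel. stft gauss f x \<xi> * (cis (2 * pi * \<xi> * t) * gauss (t - x)))"
    using lborel_pair.integral_fst'[OF I] by (simp add: lborel_prod)
  also have "\<dots> = (LINT x|lborel. f t * complex_of_real ((cmod (gauss (x - t)))\<^sup>2))"
  proof (rule integral_cong_AE)
    show "(\<lambda>x. LINT \<xi>|lborel. stft gauss f x \<xi> * (cis (2 * pi * \<xi> * t) * gauss (t - x))) \<in> borel_measurable lborel"
      using borel_measurable_integrable[OF lborel_pair.integrable_fst'[OF I]] by simp
    show "AE x in lborel. (LINT \<xi>|lborel. stft gauss f x \<xi> * (cis (2 * pi * \<xi> * t) * gauss (t - x))) =
       f t * complex_of_real ((cmod (gauss (x - t)))\<^sup>2)"
      using feichtinger_inversion_AE[OF f]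
    proof eventually_elim
      case (elim x)
      have "(LINT \<xi>|lborel. stft gauss f x \<xi> * (cis (2 * pi * \<xi> * t) * gauss (t - x))) =
         (LINT \<xi>|lborel. stft gauss f x \<xi> * cis (2 * pi * \<xi> * t)) * gauss (t - x)"
        by (simp add: mult.assoc flip: integral_mult_left_zero)
      also have "\<dots> = f t * gauss (t - x) * gauss (t - x)" using elim by simp
      also have "\<dots> = f t * complex_of_real ((cmod (gauss (x - t)))\<^sup>2)"
        unfolding gauss_def power2_commute[of t x] by (simp add: power2_eq_square mult.assoc)
      finally show ?case .
    qed
  qed measurable
  also have "\<dots> = f t * complex_of_real (LINT x|lborel. (cmod (gauss (x - t)))\<^sup>2)"
    unfolding integral_mult_right_zero integral_complex_of_real ..
  finally show ?thesis unfolding integral_gauss_shift_power2 by simp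
qed

text \<open>
  Insert the reconstruction formula for \<open>f\<close> and exchange the integrals.  Integrability of \<open>u\<close> is
  enough for this, so the identity can be tested against Gaussians and against other elements of the
  algebra alike.
\<close>
lemma feichtinger_moyal:
  assumes f: "f \<in> feichtinger" and u: "integrable lborel u"
  shows "L2_inner f u / sqrt 2 = (LINT (x, \<xi>)|lborel. stft gauss f x \<xi> * cnj (stft gauss u x \<xi>))"
proof -
  note F = feichtingerD[OF f]
  have [measurable]: "(\<lambda>(x, \<xi>). stft gauss f x \<xi>) \<in> borel_measurable borel"
    using F(4) by (auto dest: borel_measurable_integrable)
  then have [measurable]: "(\<lambda>(x, \<xi>). stft gauss f x \<xi>) \<in> borel_measurable (borel \<Otimes>\<^sub>M borel)"
    by (simp add: borel_prod)
  have [measurable]: "u \<in> borel_measurable borel" using u by (auto dest: borel_measurable_integrable)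
  let ?K = "\<lambda>p t. case p of (x, \<xi>) \<Rightarrow> stft gauss f x \<xi> * (cis (2 * pi * \<xi> * t) * gauss (t - x) * cnj (u t))"
  \<comment> \<open>Since the Gaussian is at most 1, the triple integrand is dominated by a tensor product.\<close>
  have I: "integrable (lborel \<Otimes>\<^sub>M lborel) (\<lambda>(p, t). ?K p t)"
  proof (rule Bochner_Integration.integrable_bound)
    show "integrable (lborel \<Otimes>\<^sub>M lborel) (\<lambda>(p, t). (case p of (x, \<xi>) \<Rightarrow> stft gauss f x \<xi>) * u t)"
      by (rule integrable_tensor_product[OF F(4) u])
    have "(\<lambda>(p, t). ?K p t) \<in> borel_measurable ((lborel \<Otimes>\<^sub>M lborel) \<Otimes>\<^sub>M lborel)"
      by measurable
    then show "(\<lambda>(p, t). ?K p t) \<in> borel_measurable (lborel \<Otimes>\<^sub>M lborel)"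
      by (simp add: lborel_prod)
    show "AE q in lborel \<Otimes>\<^sub>M lborel. norm (case q of (p, t) \<Rightarrow> ?K p t) \<le> norm (case q of (p, t) \<Rightarrow> (case p of (x, \<xi>) \<Rightarrow> stft gauss f x \<xi>) * u t)"
    proof (intro AE_I2)
      fix q :: "(real \<times> real) \<times> real"
      obtain x \<xi> t where q: "q = ((x, \<xi>), t)" by (metis prod.collapse)
      have "norm (gauss (t - x)) * norm (u t) \<le> norm (u t)"
        using mult_right_mono[OF norm_gauss_le_1 norm_ge_zero] by fastforce
      then show "norm (case q of (p, t) \<Rightarrow> ?K p t) \<le> norm (case q of (p, t) \<Rightarrow> (case p of (x, \<xi>) \<Rightarrow> stft gauss f x \<xi>) * u t)"
        unfolding q by (simp add: norm_mult mult_left_mono)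
    qed
  qed
  have "L2_inner f u / sqrt 2 = (LINT t|lborel. (f t / sqrt 2) * cnj (u t))"
    by (simp add: L2_inner_def)
  also have "\<dots> = (LINT t|lborel. LINT p|lborel. ?K p t)"
  proof (rule Bochner_Integration.integral_cong[OF refl])
    fix t
    show "(f t / sqrt 2) * cnj (u t) = (LINT p|lborel. ?K p t)"
      unfolding feichtinger_reconstruction[OF f] integral_mult_left_zero[symmetric]
      by (rule Bochner_Integration.integral_cong[OF refl]) (auto simp: mult.assoc)
  qed
  also have "\<dots> = (LINT p|lborel. LINT t|lborel. ?K p t)"
    by (rule lborel_pair.Fubini_integral[OF I])
  also have "\<dots> = (LINT (x, \<xi>)|lborel. stft gauss f x \<xi> * cnj (stft gauss u x \<xi>))"
  proof (rule Bochner_Integration.integral_cong[OF refl], clarify)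
    fix x \<xi>
    show "(LINT t|lborel. stft gauss f x \<xi> * (cis (2 * pi * \<xi> * t) * gauss (t - x) * cnj (u t))) = stft gauss f x \<xi> * cnj (stft gauss u x \<xi>)"
      unfolding stft_gauss_eq[of u] Bochner_Integration.integral_cnj[symmetric] integral_mult_right_zero[symmetric]
      by (rule Bochner_Integration.integral_cong[OF refl]) (simp add: cis_cnj gauss_def mult_ac)
  qed
  finally show ?thesis .
qed

section \<open>Term-by-term integration\<close>

text \<open>
  The unordered counterpart of the term-by-term integration theorem for series, obtained by
  enumerating the index set.
\<close>
lemma has_sum_integral:
  fixes f :: "'i \<Rightarrow> 'a \<Rightarrow> complex"
  assumes A: "countable A" "infinite A"
    and int: "\<And>i. i \<in> A \<Longrightarrow> integrable M (f i)"
    and pt: "\<And>x. (\<lambda>i. norm (f i x)) summable_on A"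
    and nrm: "(\<lambda>i. LINT x|M. norm (f i x)) summable_on A"
  shows "integrable M (\<lambda>x. \<Sum>\<^sub>\<infinity>i\<in>A. f i x)"
    and "((\<lambda>i. LINT x|M. f i x) has_sum (LINT x|M. (\<Sum>\<^sub>\<infinity>i\<in>A. f i x))) A"
proof -
  define e where "e = from_nat_into A"
  have e: "bij_betw e UNIV A"
    unfolding e_def using A by (rule bij_betw_from_nat_into)
  then have eA: "e n \<in> A" for n by (auto simp: bij_betw_def)
  have pt': "summable (\<lambda>n. norm (f (e n) x))" for x
    using pt[of x] summable_on_reindex_bij_betw[OF e, of "\<lambda>i. norm (f i x)"]
    by (auto intro: summable_on_imp_summable)
  have nrm': "summable (\<lambda>n. LINT x|M. norm (f (e n) x))"
    using nrm summable_on_reindex_bij_betw[OF e, of "\<lambda>i. LINT x|M. norm (f i x)"]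
    by (auto intro: summable_on_imp_summable)
  have eq: "(\<Sum>n. f (e n) x) = (\<Sum>\<^sub>\<infinity>i\<in>A. f i x)" for x
  proof -
    have "((\<lambda>n. f (e n) x) has_sum (\<Sum>n. f (e n) x)) UNIV"
      using pt'[of x] summable_sums[OF summable_norm_cancel[OF pt'[of x]]]
      by (rule norm_summable_imp_has_sum)
    then have "((\<lambda>i. f i x) has_sum (\<Sum>n. f (e n) x)) A"
      using has_sum_reindex_bij_betw[OF e, of "\<lambda>i. f i x"] by simp
    then show ?thesis by (simp add: infsumI)
  qed
  show "integrable M (\<lambda>x. \<Sum>\<^sub>\<infinity>i\<in>A. f i x)"
    unfolding eq[symmetric] using int eA pt' nrm' by (intro integrable_suminf) auto
  have s: "(\<lambda>n. LINT x|M. f (e n) x) sums (LINT x|M. (\<Sum>\<^sub>\<infinity>i\<in>A. f i x))"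
    unfolding eq[symmetric] using int eA pt' nrm' by (intro sums_integral) auto
  have "((\<lambda>n. LINT x|M. f (e n) x) has_sum (LINT x|M. (\<Sum>\<^sub>\<infinity>i\<in>A. f i x))) UNIV"
  proof (rule norm_summable_imp_has_sum[OF _ s])
    show "summable (\<lambda>n. norm (LINT x|M. f (e n) x))"
      by (rule summable_comparison_test'[OF nrm', of 0]) (simp add: integral_norm_bound)
  qed
  then show "((\<lambda>i. LINT x|M. f i x) has_sum (LINT x|M. (\<Sum>\<^sub>\<infinity>i\<in>A. f i x))) A"
    using has_sum_reindex_bij_betw[OF e, of "\<lambda>i. LINT x|M. f i x"] by simp
qed

lemma has_sum_set_integral_uniform:
  fixes f :: "'i \<Rightarrow> 'a \<Rightarrow> complex"
  assumes A: "countable A" "infinite A"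
    and S: "S \<in> sets M" "emeasure M S < \<infinity>"
    and meas: "\<And>i. f i \<in> borel_measurable M"
    and bnd: "\<And>i x. i \<in> A \<Longrightarrow> x \<in> S \<Longrightarrow> norm (f i x) \<le> C i"
    and C: "C summable_on A"
  shows "set_integrable M S (\<lambda>x. \<Sum>\<^sub>\<infinity>i\<in>A. f i x)"
    and "((\<lambda>i. LINT x:S|M. f i x) has_sum (LINT x:S|M. (\<Sum>\<^sub>\<infinity>i\<in>A. f i x))) A"
proof -
  let ?g = "\<lambda>i x. indicator S x *\<^sub>R f i x"
  have ind: "integrable M (\<lambda>x. \<bar>C i\<bar> * indicator S x)" for i
    using S by simp
  have le: "norm (?g i x) \<le> \<bar>C i\<bar> * indicator S x" if "i \<in> A" for i x
    using bnd[OF that, of x] by (auto simp: indicator_def)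
  have int: "integrable M (?g i)" if "i \<in> A" for i
  proof (rule Bochner_Integration.integrable_bound[OF ind])
    show "?g i \<in> borel_measurable M"
      using meas S(1) by (intro borel_measurable_scaleR) auto
    show "AE x in M. norm (?g i x) \<le> norm (\<bar>C i\<bar> * indicator S x)"
      using le[OF that] by (intro AE_I2) auto
  qed
  have absC: "(\<lambda>i. \<bar>C i\<bar>) summable_on A"
    using C summable_on_iff_abs_summable_on_real by auto
  have pt: "(\<lambda>i. norm (?g i x)) summable_on A" for x
    by (rule Infinite_Sum.abs_summable_on_comparison_test'[OF absC])
       (use bnd in \<open>force simp: indicator_def\<close>)
  have nrm: "(\<lambda>i. LINT x|M. norm (?g i x)) summable_on A"
  proof (rule summable_on_comparison_test)
    show "(\<lambda>i. \<bar>C i\<bar> * measure M S) summable_on A" by (rule summable_on_cmult_left[OF absC])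
    show "(LINT x|M. norm (?g i x)) \<le> \<bar>C i\<bar> * measure M S" if "i \<in> A" for i
    proof -
      have "(LINT x|M. norm (?g i x)) \<le> (LINT x|M. \<bar>C i\<bar> * indicator S x)"
        using le[OF that] by (intro integral_mono integrable_norm int that ind)
      also have "\<dots> = \<bar>C i\<bar> * measure M S" using sets.sets_into_space[OF S(1)] by (simp add: Int_absorb2)
      finally show ?thesis .
    qed
  qed (auto intro: integral_nonneg_AE)
  have eq: "(\<Sum>\<^sub>\<infinity>i\<in>A. ?g i x) = indicator S x *\<^sub>R (\<Sum>\<^sub>\<infinity>i\<in>A. f i x)" for x
    by (auto simp: indicator_def)
  show "set_integrable M S (\<lambda>x. \<Sum>\<^sub>\<infinity>i\<in>A. f i x)"
    using has_sum_integral(1)[OF A int pt nrm] unfolding set_integrable_def eq .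
  show "((\<lambda>i. LINT x:S|M. f i x) has_sum (LINT x:S|M. (\<Sum>\<^sub>\<infinity>i\<in>A. f i x))) A"
    using has_sum_integral(2)[OF A int pt nrm] unfolding set_lebesgue_integral_def eq .
qed

lemma continuous_on_infsum_uniform:
  fixes f :: "'i \<Rightarrow> 'a :: topological_space \<Rightarrow> complex"
  assumes "\<And>i. i \<in> A \<Longrightarrow> continuous_on S (f i)"
    and bnd: "\<And>i x. i \<in> A \<Longrightarrow> x \<in> S \<Longrightarrow> norm (f i x) \<le> C i" and C: "C summable_on A"
  shows "continuous_on S (\<lambda>x. \<Sum>\<^sub>\<infinity>i\<in>A. f i x)"
proof (rule uniform_limit_theorem)
  show "uniform_limit S (\<lambda>X y. \<Sum>x\<in>X. f x y) (\<lambda>y. \<Sum>\<^sub>\<infinity>x\<in>A. f x y) (finite_subsets_at_top A)"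
    using bnd C by (rule Weierstrass_m_test_general)
  show "\<forall>\<^sub>F X in finite_subsets_at_top A. continuous_on S (\<lambda>y. \<Sum>x\<in>X. f x y)"
    unfolding eventually_finite_subsets_at_top
    using assms(1) by (intro exI[of _ "{}"]) (auto intro!: continuous_on_sum)
qed simp

section \<open>Functions with summable local suprema\<close>

lemma amalgam_bound_nonneg: "amalgam_bound B f \<Longrightarrow> 0 \<le> B k"
proof -
  assume "amalgam_bound B f"
  then have "norm (f (of_int k)) \<le> B \<lfloor>real_of_int k\<rfloor>" unfolding amalgam_bound_def by blast
  then show ?thesis using norm_ge_zero[of "f (of_int k)"] unfolding floor_of_int by linarith
qed

lemma summable_on_shift_int:
  fixes B :: "int \<Rightarrow> real"
  assumes "B summable_on UNIV"
  shows "(\<lambda>k. B (m + k)) summable_on UNIV"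
proof -
  have "bij (\<lambda>k :: int. m + k)"
    by (rule bij_betwI[of _ _ _ "\<lambda>k. k - m"]) simp_all
  from summable_on_reindex_bij_betw[OF this, of B] assms show ?thesis by simp
qed

lemma amalgam_summable:
  assumes "amalgam_bound B f"
  shows "(\<lambda>k :: int. norm (f (t + of_int k))) summable_on UNIV"
proof (rule Infinite_Sum.abs_summable_on_comparison_test')
  show "(\<lambda>k. B (\<lfloor>t\<rfloor> + k)) summable_on UNIV"
    using assms by (intro summable_on_shift_int) (simp add: amalgam_bound_def)
  show "norm (f (t + of_int k)) \<le> B (\<lfloor>t\<rfloor> + k)" for k
    using assms unfolding amalgam_bound_def floor_add_int by blast
qed

text \<open>
  A single summable majorant for all \<open>t\<close> in \<open>[-1, 1]\<close>, which covers every difference of a sampling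
  point \<open>n / N\<close> and a point \<open>x\<close> of the unit interval.
\<close>
lemma amalgam_uniform_bound:
  assumes B: "amalgam_bound B f"
  shows "(\<lambda>k. B (k - 1) + B k + B (k + 1)) summable_on UNIV"
    and "\<And>t k. t \<in> {-1..1} \<Longrightarrow> norm (f (t + of_int k)) \<le> B (k - 1) + B k + B (k + 1)"
proof -
  have s: "B summable_on UNIV" using B by (simp add: amalgam_bound_def)
  show "(\<lambda>k. B (k - 1) + B k + B (k + 1)) summable_on UNIV"
    using s summable_on_shift_int[OF s, of "-1"] summable_on_shift_int[OF s, of 1]
    by (intro summable_on_add) (simp_all add: add.commute)
  fix t :: real and k assume t: "t \<in> {-1..1}"
  have "norm (f (t + of_int k)) \<le> B (\<lfloor>t\<rfloor> + k)"
    using B unfolding amalgam_bound_def floor_add_int by blast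
  moreover have "\<lfloor>t\<rfloor> = -1 \<or> \<lfloor>t\<rfloor> = 0 \<or> \<lfloor>t\<rfloor> = 1" using t by (auto simp: floor_eq_iff)
  ultimately show "norm (f (t + of_int k)) \<le> B (k - 1) + B k + B (k + 1)"
    using amalgam_bound_nonneg[OF B, of "k-1"] amalgam_bound_nonneg[OF B, of "k"] amalgam_bound_nonneg[OF B, of "k+1"]
    by (auto simp: add.commute)
qed

text \<open>
  Cut \<open>f\<close> along the half-open unit intervals, so that the pieces add up to \<open>f\<close> at every point, and
  shift each piece back to the unit interval.
\<close>
lemma amalgam_integral:
  assumes B: "amalgam_bound B f" and [measurable]: "f \<in> borel_measurable borel"
  shows "integrable lborel f"
    and "((\<lambda>k :: int. LINT t:{0..1}|lborel. f (t + of_int k)) has_sum (LINT t|lborel. f t)) UNIV"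
proof -
  let ?I = "\<lambda>k :: int. {real_of_int k..<real_of_int k + 1}"
  let ?g = "\<lambda>k t. indicator (?I k) t *\<^sub>R f t"
  have ind: "integrable lborel (\<lambda>t. B k * indicator (?I k) t)" for k by simp
  have fB: "norm (f t) \<le> B \<lfloor>t\<rfloor>" for t using B by (simp add: amalgam_bound_def)
  have le: "norm (?g k t) \<le> B k * indicator (?I k) t" for k t
    using fB[of t] unfolding indicator_unit_interval by auto
  have int: "integrable lborel (?g k)" for k
  proof (rule Bochner_Integration.integrable_bound[OF ind])
    show "AE t in lborel. norm (?g k t) \<le> norm (B k * indicator (?I k) t)"
      unfolding real_norm_def by (intro AE_I2 order_trans[OF le abs_ge_self])
  qed measurable
  have Bs: "B summable_on UNIV" using B by (simp add: amalgam_bound_def)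
  have val: "((\<lambda>k. ?g k t) has_sum f t) UNIV" for t
  proof -
    have "((\<lambda>k. ?g k t) has_sum f t) {\<lfloor>t\<rfloor>}"
      unfolding indicator_unit_interval by (simp add: has_sum_finite_iff)
    moreover have "((\<lambda>k. ?g k t) has_sum f t) {\<lfloor>t\<rfloor>} \<longleftrightarrow> ((\<lambda>k. ?g k t) has_sum f t) UNIV"
      by (rule has_sum_cong_neutral) (auto simp: indicator_unit_interval)
    ultimately show ?thesis by simp
  qed
  have pt: "(\<lambda>k. norm (?g k t)) summable_on UNIV" for t
    using has_sum_imp_summable[OF val[of t]] unfolding summable_on_iff_abs_summable_on_complex .
  have nrm: "(\<lambda>k. LINT t|lborel. norm (?g k t)) summable_on UNIV"
  proof (rule summable_on_comparison_test[OF Bs])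
    fix k :: int
    have "(LINT t|lborel. norm (?g k t)) \<le> (LINT t|lborel. B k * indicator (?I k) t)"
      by (intro integral_mono integrable_norm int ind le)
    then show "(LINT t|lborel. norm (?g k t)) \<le> B k" by simp
  qed (auto intro: integral_nonneg_AE)
  have eq: "(\<Sum>\<^sub>\<infinity>k. ?g k t) = f t" for t using val[of t] by (rule infsumI)
  have inf: "infinite (UNIV :: int set)" by (rule infinite_UNIV_int)
  show "integrable lborel f"
    using has_sum_integral(1)[OF _ inf int pt nrm] unfolding eq by simp
  have "((\<lambda>k. LINT t|lborel. ?g k t) has_sum (LINT t|lborel. f t)) UNIV"
    using has_sum_integral(2)[OF _ inf int pt nrm] unfolding eq by simp
  moreover have "(LINT t|lborel. ?g k t) = (LINT t:{0..1}|lborel. f (t + of_int k))" for k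
  proof -
    have "(LINT t|lborel. ?g k t) = (LINT t|lborel. ?g k (of_int k + 1 * t))"
      by (subst lborel_integral_real_affine[of 1 _ "of_int k"]) simp_all
    also have "\<dots> = (LINT t|lborel. indicator {0..1} t *\<^sub>R f (t + of_int k))"
    proof (rule integral_cong_AE)
      have "AE t in lborel. t \<noteq> (1 :: real)" by (rule AE_lborel_singleton)
      then show "AE t in lborel. ?g k (of_int k + 1 * t) = indicator {0..1} t *\<^sub>R f (t + of_int k)"
        by eventually_elim (auto simp: indicator_def add.commute)
    qed measurable
    finally show ?thesis by (simp add: set_lebesgue_integral_def)
  qed
  ultimately show "((\<lambda>k. LINT t:{0..1}|lborel. f (t + of_int k)) has_sum (LINT t|lborel. f t)) UNIV"
    by simp
qed

lemma feichtinger_integrable: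
  assumes f: "f \<in> feichtinger"
  shows "integrable lborel f"
proof -
  obtain B where "amalgam_bound B f" by (rule feichtinger_amalgam[OF f])
  then show ?thesis by (rule amalgam_integral(1)) (rule feichtingerD(1)[OF f])
qed

section \<open>Lattice sums of short-time Fourier transforms\<close>

lemma summable_inverse_square_int: "(\<lambda>k :: int. 1 / (1 + (real_of_int k)\<^sup>2)) summable_on UNIV"
proof -
  let ?f = "\<lambda>k :: int. 1 / (1 + (real_of_int k)\<^sup>2)"
  have "summable (\<lambda>n. norm (1 / (1 + (real n)\<^sup>2)))"
  proof (rule summable_comparison_test'[of "\<lambda>n. 1 / real n ^ 2" 1])
    show "summable (\<lambda>n. 1 / real n ^ 2)"
      using inverse_power_summable[of 2, where 'a = real] by (simp add: field_simps)
    fix n :: nat assume "1 \<le> n"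
    have "norm (1 / (1 + (real n)\<^sup>2)) = 1 / (1 + (real n)\<^sup>2)"
      by (simp add: add_nonneg_nonneg)
    also have "\<dots> \<le> 1 / real n ^ 2"
      using \<open>1 \<le> n\<close> by (intro divide_left_mono) (auto simp: add_pos_nonneg)
    finally show "norm (norm (1 / (1 + (real n)\<^sup>2))) \<le> 1 / real n ^ 2" by simp
  qed
  then have nat: "(\<lambda>n. 1 / (1 + (real n)\<^sup>2)) summable_on UNIV"
    by (rule norm_summable_imp_summable_on)
  have "?f summable_on range int" "?f summable_on range (\<lambda>n. - int n)"
    using nat by (subst summable_on_reindex; simp add: inj_on_def o_def)+
  then have "?f summable_on (range int \<union> range (\<lambda>n. - int n))"
    by (rule summable_on_union)
  moreover have "range int \<union> range (\<lambda>n. - int n) = UNIV"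
  proof (intro set_eqI iffI UNIV_I)
    fix k :: int
    show "k \<in> range int \<union> range (\<lambda>n. - int n)"
      by (cases k rule: int_cases2) auto
  qed
  ultimately show ?thesis by simp
qed

text \<open>
  The bound is uniform in the offset \<open>x\<close>: moving \<open>x + k\<close> to the integer \<open>k + \<lfloor>x\<rfloor>\<close> changes it by
  less than 1 and costs only a factor 3 in the comparison with \<open>1 / (1 + j\<^sup>2)\<close>.
\<close>
lemma gaussian_lattice_sum_bounded:
  "\<exists>K. \<forall>x. \<forall>A :: int set. finite A \<longrightarrow> (\<Sum>k\<in>A. exp (- pi * (x + real_of_int k)\<^sup>2 / 2)) \<le> K"
proof -
  let ?w = "\<lambda>j :: int. 3 * (1 / (1 + (real_of_int j)\<^sup>2))"
  have w: "?w summable_on UNIV"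
    by (rule summable_on_cmult_right) (rule summable_inverse_square_int)
  have "(\<Sum>k\<in>A. exp (- pi * (x + real_of_int k)\<^sup>2 / 2)) \<le> infsum ?w UNIV" if "finite A" for x and A :: "int set"
  proof -
    have "exp (- pi * (x + real_of_int k)\<^sup>2 / 2) \<le> ?w (k + \<lfloor>x\<rfloor>)" for k
    proof -
      define y j where "y = x + real_of_int k" and "j = real_of_int (k + \<lfloor>x\<rfloor>)"
      have r: "\<bar>j - y\<bar> \<le> 1" unfolding y_def j_def by linarith
      then have "(j - y)\<^sup>2 \<le> 1" by (simp add: abs_square_le_1)
      moreover have "j\<^sup>2 \<le> 2 * y\<^sup>2 + 2 * (j - y)\<^sup>2"
        using zero_le_power2[of "2 * y - j"] by (simp add: power2_eq_square algebra_simps)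
      ultimately have j: "1 + j\<^sup>2 \<le> 3 * (1 + y\<^sup>2)"
        using zero_le_power2[of y] unfolding distrib_left by linarith
      have "1 + y\<^sup>2 \<le> 1 + pi * y\<^sup>2 / 2"
        using mult_right_mono[of 2 pi "y\<^sup>2"] pi_ge_two by simp
      also have "\<dots> \<le> exp (pi * y\<^sup>2 / 2)" by (rule exp_ge_add_one_self)
      finally have "exp (- (pi * y\<^sup>2 / 2)) \<le> 1 / (1 + y\<^sup>2)"
        by (simp add: exp_minus field_simps add_pos_nonneg)
      also have "\<dots> \<le> 3 * (1 / (1 + j\<^sup>2))"
        using j by (simp add: field_simps add_pos_nonneg)
      finally show ?thesis by (simp add: y_def j_def)
    qed
    then have "(\<Sum>k\<in>A. exp (- pi * (x + real_of_int k)\<^sup>2 / 2)) \<le> (\<Sum>k\<in>A. ?w (k + \<lfloor>x\<rfloor>))"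
      by (rule sum_mono)
    also have "\<dots> = sum ?w ((\<lambda>k. k + \<lfloor>x\<rfloor>) ` A)"
      by (subst sum.reindex) (auto simp: inj_on_def)
    also have "\<dots> \<le> infsum ?w UNIV"
      using that by (intro finite_sum_le_infsum w) auto
    finally show ?thesis .
  qed
  then show ?thesis by blast
qed

text \<open>
  The product of two shifted Gaussians is a Gaussian centred at the midpoint, which makes the
  transform explicit.
\<close>
lemma norm_stft_gauss_gauss:
  "norm (stft gauss gauss x \<xi>) \<le> exp (- pi * x\<^sup>2 / 2) * exp (- pi * \<xi>\<^sup>2 / 2)"
proof -
  let ?h = "\<lambda>t. gauss t * gauss (t - x) * cis (- (2 * pi * \<xi> * t))"
  let ?c = "complex_of_real (exp (- pi * x\<^sup>2 / 2)) * cis (- (pi * \<xi> * x))"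
  have h: "?h (x / 2 + 1 * t) = ?c * (cis (2 * pi * (- \<xi>) * t) * complex_of_real (exp (- pi * (sqrt 2 * t)\<^sup>2)))" for t
  proof -
    have "gauss (x / 2 + 1 * t) * gauss (x / 2 + 1 * t - x) = complex_of_real (exp (- pi * x\<^sup>2 / 2) * exp (- pi * (sqrt 2 * t)\<^sup>2))"
      by (simp add: gauss_def power2_eq_square algebra_simps flip: of_real_mult exp_add)
    moreover have "cis (- (2 * pi * \<xi> * (x / 2 + 1 * t))) = cis (- (pi * \<xi> * x)) * cis (2 * pi * (- \<xi>) * t)"
      by (simp add: cis_mult algebra_simps)
    ultimately show ?thesis by simp
  qed
  have "stft gauss gauss x \<xi> = (LINT t|lborel. ?h (x / 2 + 1 * t))"
    unfolding stft_gauss_eq by (subst lborel_integral_real_affine[of 1 _ "x / 2"]) simp_all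
  also have "\<dots> = ?c * complex_of_real (exp (- pi * (- \<xi> / sqrt 2)\<^sup>2) / sqrt 2)"
    unfolding h integral_mult_right_zero by (subst fourier_gaussian) simp_all
  finally have "norm (stft gauss gauss x \<xi>) = norm (?c * complex_of_real (exp (- pi * (- \<xi> / sqrt 2)\<^sup>2) / sqrt 2))"
    by simp
  also have "\<dots> = exp (- pi * x\<^sup>2 / 2) * (exp (- pi * \<xi>\<^sup>2 / 2) / sqrt 2)"
    by (simp add: norm_mult norm_divide power_divide)
  also have "\<dots> \<le> exp (- pi * x\<^sup>2 / 2) * exp (- pi * \<xi>\<^sup>2 / 2)"
    by (intro mult_left_mono) (simp_all add: divide_le_eq)
  finally show ?thesis .
qed

lemma integrable_gauss: "integrable lborel gauss"
  using integrable_gaussian[of 1] by (simp add: gauss_def[abs_def])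

lemma integrable_tf_shift:
  assumes "integrable lborel f"
  shows "integrable lborel (tf_shift a b f)"
proof (rule Bochner_Integration.integrable_bound)
  show I: "integrable lborel (\<lambda>t. f (-a + 1 * t))"
    by (intro lborel_integrable_real_affine assms) simp
  have "(\<lambda>t. f (-a + 1 * t)) \<in> borel_measurable lborel"
    using I by (rule borel_measurable_integrable)
  then show "tf_shift a b f \<in> borel_measurable lborel"
    unfolding tf_shift_def modulation_def translation_def by (intro borel_measurable_times) auto
qed (simp add: tf_shift_def modulation_def translation_def norm_mult)

text \<open>
  A Schur-type estimate: only the sum of the kernels over the index set has to be bounded.
\<close>
lemma sum_le_of_kernel_bound:
  fixes p :: "'a \<Rightarrow> real" and q :: "'i \<Rightarrow> 'a \<Rightarrow> real"
  assumes p: "integrable M p" "\<And>z. 0 \<le> p z"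
    and q: "\<And>i. q i \<in> borel_measurable M" "\<And>i z. 0 \<le> q i z"
    and K: "\<And>z. (\<Sum>i\<in>I. q i z) \<le> K"
    and a: "\<And>i. a i \<le> (LINT z|M. p z * q i z)"
    and I: "finite I"
  shows "(\<Sum>i\<in>I. a i) \<le> K * (LINT z|M. p z)"
proof -
  have qK: "q i z \<le> K" if "i \<in> I" for i z
    using member_le_sum[OF that, of "\<lambda>i. q i z"] q I K[of z] by simp
  have int: "integrable M (\<lambda>z. p z * q i z)" if "i \<in> I" for i
  proof (rule Bochner_Integration.integrable_bound)
    show "integrable M (\<lambda>z. p z * K)" using p by simp
    show "(\<lambda>z. p z * q i z) \<in> borel_measurable M" using p q by auto
    show "AE z in M. norm (p z * q i z) \<le> norm (p z * K)"
    proof (intro AE_I2)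
      fix z
      have "0 \<le> p z * q i z" "p z * q i z \<le> p z * K"
        using p q qK[OF that] by (auto intro: mult_left_mono)
      then show "norm (p z * q i z) \<le> norm (p z * K)" by simp
    qed
  qed
  have "(\<Sum>i\<in>I. a i) \<le> (\<Sum>i\<in>I. LINT z|M. p z * q i z)"
    by (intro sum_mono a)
  also have "\<dots> = (LINT z|M. (\<Sum>i\<in>I. p z * q i z))"
    by (rule Bochner_Integration.integral_sum[symmetric]) (rule int)
  also have "\<dots> \<le> (LINT z|M. p z * K)"
  proof (rule integral_mono)
    show "integrable M (\<lambda>z. \<Sum>i\<in>I. p z * q i z)" using int by simp
    show "integrable M (\<lambda>z. p z * K)" using p by simp
    show "(\<Sum>i\<in>I. p z * q i z) \<le> p z * K" for z
      unfolding sum_distrib_left[symmetric] by (intro mult_left_mono K p)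
  qed
  finally show ?thesis by (simp add: mult.commute)
qed

text \<open>
  A time-frequency shift of \<open>u\<close> only translates \<open>|V u|\<close>, so the Moyal identity turns the inner product
  into a correlation on phase space.
\<close>
lemma norm_L2_inner_le_moyal:
  assumes f: "f \<in> feichtinger" and u: "integrable lborel u"
  shows "norm (L2_inner f (tf_shift a b u)) / sqrt 2 \<le>
    (LINT p|lborel. norm (case_prod (stft gauss f) p) * norm (stft gauss u (fst p - a) (snd p - b)))"
proof -
  have "norm (L2_inner f (tf_shift a b u)) / sqrt 2 = norm (L2_inner f (tf_shift a b u) / sqrt 2)"
    by (simp add: norm_divide)
  also have "\<dots> = norm (LINT (x, \<xi>)|lborel. stft gauss f x \<xi> * cnj (stft gauss (tf_shift a b u) x \<xi>))"
    by (simp only: feichtinger_moyal[OF f integrable_tf_shift[OF u]])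
  also have "\<dots> \<le> (LINT p|lborel. norm (case p of (x, \<xi>) \<Rightarrow> stft gauss f x \<xi> * cnj (stft gauss (tf_shift a b u) x \<xi>)))"
    by (rule integral_norm_bound)
  also have "\<dots> = (LINT p|lborel. norm (case_prod (stft gauss f) p) * norm (stft gauss u (fst p - a) (snd p - b)))"
    by (rule Bochner_Integration.integral_cong[OF refl]) (auto simp: norm_mult norm_stft_tf_shift)
  finally show ?thesis .
qed

lemma lattice_finite_sum_le_product:
  fixes a b :: "int \<Rightarrow> real"
  assumes "\<And>k. 0 \<le> a k" "\<And>k. 0 \<le> b k" and \<Lambda>: "finite \<Lambda>"
    and "\<And>A. finite A \<Longrightarrow> sum a A \<le> K" "\<And>A. finite A \<Longrightarrow> sum b A \<le> L"
  shows "(\<Sum>(k, l)\<in>\<Lambda>. a k * b l) \<le> K * L"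
proof -
  have "(\<Sum>(k, l)\<in>\<Lambda>. a k * b l) \<le> (\<Sum>(k, l)\<in>fst ` \<Lambda> \<times> snd ` \<Lambda>. a k * b l)"
    using assms by (intro sum_mono2) (auto simp: rev_image_eqI)
  also have "\<dots> = sum a (fst ` \<Lambda>) * sum b (snd ` \<Lambda>)"
    by (simp add: sum_product sum.cartesian_product)
  also have "\<dots> \<le> K * L"
    using assms by (intro mult_mono) (auto intro: sum_nonneg order_trans[OF sum_nonneg])
  finally show ?thesis .
qed

text \<open>
  Testing the Moyal identity against the Gaussian bounds \<open>|V f|\<close> by its own convolution with the
  Gaussian \<open>|V h\<^sub>0|\<close>, and lattice sums of the latter are uniformly bounded.
\<close>
lemma feichtinger_stft_lattice_sum_bounded:
  assumes f: "f \<in> feichtinger"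
  shows "\<exists>K. \<forall>x \<xi>. \<forall>\<Lambda> :: (int \<times> int) set. finite \<Lambda> \<longrightarrow>
    (\<Sum>(k, l)\<in>\<Lambda>. norm (stft gauss f (x - of_int k) (\<xi> - of_int l))) \<le> K"
proof -
  note F = feichtingerD[OF f]
  let ?e = "\<lambda>x :: real. exp (- pi * x\<^sup>2 / 2)"
  let ?p = "\<lambda>p. norm (case_prod (stft gauss f) p)"
  obtain K where K: "finite A \<Longrightarrow> (\<Sum>k\<in>A. ?e (x + real_of_int k)) \<le> K" for x A
    using gaussian_lattice_sum_bounded by blast
  have "(\<Sum>(k, l)\<in>\<Lambda>. norm (stft gauss f (x - of_int k) (\<xi> - of_int l))) \<le> K * K * (LINT p|lborel. ?p p) * sqrt 2"
    if \<Lambda>: "finite \<Lambda>" for x \<xi> and \<Lambda> :: "(int \<times> int) set"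
  proof -
    let ?q = "\<lambda>i p. ?e (fst p - x + of_int (fst i)) * ?e (snd p - \<xi> + of_int (snd i))"
    have "(\<Sum>i\<in>\<Lambda>. norm (stft gauss f (x - of_int (fst i)) (\<xi> - of_int (snd i))) / sqrt 2) \<le> K * K * (LINT p|lborel. ?p p)"
    proof (rule sum_le_of_kernel_bound[where q = ?q])
      show "integrable lborel ?p" using F(4) by simp
      show "?q i \<in> borel_measurable lborel" for i :: "int \<times> int"
        by (simp, intro borel_measurable_continuous_onI continuous_intros) auto
      show "(\<Sum>i\<in>\<Lambda>. ?q i p) \<le> K * K" for p
        using lattice_finite_sum_le_product[of "\<lambda>k. ?e (fst p - x + of_int k)" "\<lambda>k. ?e (snd p - \<xi> + of_int k)" \<Lambda> K K] K \<Lambda>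
        by (simp add: case_prod_beta)
      show "norm (stft gauss f (x - of_int (fst i)) (\<xi> - of_int (snd i))) / sqrt 2 \<le> (LINT p|lborel. ?p p * ?q i p)" for i :: "int \<times> int"
      proof -
        define a b where "a = x - of_int (fst i)" and "b = \<xi> - of_int (snd i)"
        have "norm (stft gauss f a b) / sqrt 2 \<le> (LINT p|lborel. ?p p * norm (stft gauss gauss (fst p - a) (snd p - b)))"
          using norm_L2_inner_le_moyal[OF f integrable_gauss, of a b] by (simp add: stft_def)
        also have "\<dots> \<le> (LINT p|lborel. ?p p * ?q i p)"
        proof (rule integral_mono_AE')
          show "integrable lborel (\<lambda>p. ?p p * ?q i p)"
          proof (rule Bochner_Integration.integrable_bound)
            show "integrable lborel ?p" using F(4) by simp
            have "?q i \<in> borel_measurable borel"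
              by (intro borel_measurable_continuous_onI continuous_intros) auto
            then show "(\<lambda>p. ?p p * ?q i p) \<in> borel_measurable lborel"
              using F(4) by (intro borel_measurable_times[of ?p]) auto
            show "AE p in lborel. norm (?p p * ?q i p) \<le> norm (?p p)"
              by (intro AE_I2) (simp add: abs_mult mult_left_le mult_le_one)
          qed
          have "norm (stft gauss gauss (fst p - a) (snd p - b)) \<le> ?q i p" for p
            using norm_stft_gauss_gauss[of "fst p - a" "snd p - b"] by (simp add: a_def b_def algebra_simps)
          then show "AE p in lborel. ?p p * norm (stft gauss gauss (fst p - a) (snd p - b)) \<le> ?p p * ?q i p"
            by (intro AE_I2 mult_left_mono) auto
        qed auto
        finally show ?thesis by (simp add: a_def b_def)
      qed
    qed (use \<Lambda> in auto)
    then show ?thesis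
      by (simp add: case_prod_beta field_simps flip: sum_divide_distrib)
  qed
  then show ?thesis by blast
qed

text \<open>
  Here \<open>|\<langle>f, \<pi>(\<lambda>) h\<rangle>|\<close> is bounded by the correlation of \<open>|V f|\<close> with \<open>|V h|\<close>: the first is integrable,
  and the second has uniformly bounded lattice sums.
\<close>
lemma feichtinger_lattice_summable:
  assumes f: "f \<in> feichtinger" and h: "h \<in> feichtinger"
  shows "(\<lambda>(k, l). norm (L2_inner f (tf_shift (of_int k) (of_int l) h))) summable_on (UNIV :: (int \<times> int) set)"
proof -
  note F = feichtingerD[OF f] and H = feichtingerD[OF h]
  let ?p = "\<lambda>p. norm (case_prod (stft gauss f) p)"
  let ?q = "\<lambda>i :: int \<times> int. \<lambda>p. norm (stft gauss h (fst p - of_int (fst i)) (snd p - of_int (snd i)))"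
  obtain K where K: "\<And>x \<xi> \<Lambda>. finite \<Lambda> \<Longrightarrow> (\<Sum>(k, l)\<in>\<Lambda>. norm (stft gauss h (x - of_int k) (\<xi> - of_int l))) \<le> K"
    using feichtinger_stft_lattice_sum_bounded[OF h] by blast
  have "(\<lambda>i. norm (L2_inner f (tf_shift (of_int (fst i)) (of_int (snd i)) h)) / sqrt 2) summable_on (UNIV :: (int \<times> int) set)"
  proof (rule nonneg_bdd_above_summable_on)
    show "bdd_above (sum (\<lambda>i. norm (L2_inner f (tf_shift (of_int (fst i)) (of_int (snd i)) h)) / sqrt 2) ` {\<Lambda>. \<Lambda> \<subseteq> (UNIV :: (int \<times> int) set) \<and> finite \<Lambda>})"
    proof (rule bdd_aboveI2)
      fix \<Lambda> :: "(int \<times> int) set" assume "\<Lambda> \<in> {\<Lambda>. \<Lambda> \<subseteq> UNIV \<and> finite \<Lambda>}"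
      then have \<Lambda>: "finite \<Lambda>" by simp
      show "(\<Sum>i\<in>\<Lambda>. norm (L2_inner f (tf_shift (of_int (fst i)) (of_int (snd i)) h)) / sqrt 2) \<le> K * (LINT p|lborel. ?p p)"
      proof (rule sum_le_of_kernel_bound[where q = ?q])
        show "integrable lborel ?p" using F(4) by simp
        show "?q i \<in> borel_measurable lborel" for i
        proof -
          have "(\<lambda>(x, \<xi>). stft gauss h x \<xi>) \<in> borel_measurable borel"
            using H(4) by (auto dest: borel_measurable_integrable)
          moreover have "(\<lambda>p. (fst p - of_int (fst i), snd p - of_int (snd i))) \<in> borel \<rightarrow>\<^sub>M (borel :: (real \<times> real) measure)"
            by (intro borel_measurable_continuous_onI continuous_intros)
          ultimately have "(\<lambda>p. case_prod (stft gauss h) (fst p - of_int (fst i), snd p - of_int (snd i))) \<in> borel_measurable borel"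
            by (rule measurable_compose[rotated])
          then show ?thesis by simp
        qed
        show "(\<Sum>i\<in>\<Lambda>. ?q i p) \<le> K" for p
          using K[OF \<Lambda>, of "fst p" "snd p"] by (simp add: case_prod_beta)
        show "norm (L2_inner f (tf_shift (of_int (fst i)) (of_int (snd i)) h)) / sqrt 2 \<le> (LINT p|lborel. ?p p * ?q i p)" for i :: "int \<times> int"
          by (rule norm_L2_inner_le_moyal[OF f feichtinger_integrable[OF h]])
      qed (use \<Lambda> in auto)
    qed
  qed auto
  then have "(\<lambda>i. sqrt 2 * (norm (L2_inner f (tf_shift (of_int (fst i)) (of_int (snd i)) h)) / sqrt 2)) summable_on (UNIV :: (int \<times> int) set)"
    by (rule summable_on_cmult_right)
  then show ?thesis by (simp add: case_prod_unfold)
qed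

section \<open>Poisson summation\<close>

lemma amalgam_integral_periodization:
  assumes B: "amalgam_bound B f" and meas[measurable]: "f \<in> borel_measurable borel"
  shows "(LINT t:{0..1}|lborel. (\<Sum>\<^sub>\<infinity>k::int. f (t + of_int k))) = (LINT t|lborel. f t)"
proof -
  have "((\<lambda>k :: int. LINT t:{0..1}|lborel. f (t + of_int k)) has_sum
      (LINT t:{0..1}|lborel. (\<Sum>\<^sub>\<infinity>k. f (t + of_int k)))) UNIV"
  proof (rule has_sum_set_integral_uniform(2)[OF _ infinite_UNIV_int])
    show "norm (f (t + of_int k)) \<le> B (k - 1) + B k + B (k + 1)" if "t \<in> {0..1}" for t and k :: int
      using amalgam_uniform_bound(2)[OF B, of t k] that by simp
  qed (use amalgam_uniform_bound(1)[OF B] in simp_all)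
  then show ?thesis using amalgam_integral(2)[OF B meas] by (rule has_sum_unique)
qed

text \<open>
  For \<open>r \<noteq> 0\<close> the integrality assumption says that \<open>L\<close> is a multiple of the period \<open>1 / r\<close>.
\<close>
lemma set_integral_cis:
  assumes "L > 0" and "real_of_int k = L * r"
  shows "(LINT \<xi>:{0..L}|lborel. cis (2 * pi * r * \<xi>)) = (if r = 0 then complex_of_real L else 0)"
proof (cases "r = 0")
  case True
  then show ?thesis using assms(1) by (simp add: set_lebesgue_integral_def scaleR_conv_of_real)
next
  case False
  define c where "c = 2 * complex_of_real (pi * r) * \<i>"
  have c: "c \<noteq> 0" using False by (simp add: c_def)
  have cis: "cis (2 * pi * r * \<xi>) = exp (c * of_real \<xi>)" for \<xi>
    by (simp add: cis_conv_exp c_def mult_ac)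
  have "(LINT \<xi>:{0..L}|lborel. cis (2 * pi * r * \<xi>)) = exp (c * of_real L) / c - exp (c * of_real 0) / c"
    unfolding set_lebesgue_integral_def cis
  proof (rule integral_FTC_atLeastAtMost)
    show "((\<lambda>\<xi>. exp (c * of_real \<xi>) / c) has_vector_derivative exp (c * of_real x)) (at x within {0..L})" for x
    proof -
      have "((\<lambda>z. exp (c * z) / c) has_field_derivative exp (c * of_real x)) (at (of_real x))"
        using c by (auto intro!: derivative_eq_intros)
      then show ?thesis by (rule has_vector_derivative_real_field)
    qed
  qed (use assms in \<open>auto intro!: continuous_intros\<close>)
  also have "exp (c * of_real L) = cis (2 * pi * of_int k)"
    using assms(2) cis[of L] by (simp add: mult_ac)
  finally show ?thesis using False by simp
qed

text \<open>
  If \<open>D (1/2) \<noteq> 0\<close>, test \<open>D\<close> against the trigonometric polynomials \<open>sin(\<pi> t)\<^sup>2\<^sup>n\<close>.  They are orthogonal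
  to \<open>D\<close> by assumption, but their mass concentrates at the midpoint of the unit interval, where a
  suitable real part of \<open>D\<close> is positive.
\<close>
lemma fourier_uniqueness_midpoint:
  fixes D :: "real \<Rightarrow> complex"
  assumes D: "continuous_on {0..1} D"
    and zero: "\<And>k :: int. (LINT t:{0..1}|lborel. D t * cis (2 * pi * of_int k * t)) = 0"
  shows "D (1 / 2) = 0"
proof (rule ccontr)
  assume nz: "D (1 / 2) \<noteq> 0"
  define s where "s t = complex_of_real ((sin (pi * t))\<^sup>2)" for t
  have s: "s t = 1 / 2 - (cis (2 * pi * t) + cis (- (2 * pi * t))) / 4" for t
  proof -
    have "(sin (pi * t))\<^sup>2 = 1 / 2 - cos (2 * pi * t) / 2"
      using cos_double_sin[of "pi * t"] unfolding mult.assoc by linarith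
    moreover have "cis (2 * pi * t) + cis (- (2 * pi * t)) = complex_of_real (2 * cos (2 * pi * t))"
      by (simp add: complex_eq_iff)
    ultimately show ?thesis unfolding s_def by simp
  qed
  have int: "set_integrable lborel {0..1} h" if "continuous_on {0..1} h" for h :: "real \<Rightarrow> complex"
    using that by (rule borel_integrable_atLeastAtMost')
  have trig: "(LINT t:{0..1}|lborel. D t * s t ^ n * cis (2 * pi * of_int k * t)) = 0" for n and k :: int
  proof (induction n arbitrary: k)
    case 0
    then show ?case using zero by simp
  next
    case (Suc n)
    let ?h = "\<lambda>k t. D t * s t ^ n * cis (2 * pi * of_int k * t)"
    have cont: "continuous_on {0..1} (?h k)" for k :: int
      unfolding s_def by (intro continuous_intros D)
    have i: "set_integrable lborel {0..1} (\<lambda>t. c * ?h k t)" for c and k :: int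
      by (intro set_integrable_mult_right int cont)
    have eq: "D t * s t ^ Suc n * cis (2 * pi * of_int k * t) = 1 / 2 * ?h k t - (1 / 4 * ?h (k + 1) t + 1 / 4 * ?h (k - 1) t)" for t
    proof -
      have "cis (2 * pi * of_int (k + 1) * t) = cis (2 * pi * of_int k * t) * cis (2 * pi * t)"
        "cis (2 * pi * of_int (k - 1) * t) = cis (2 * pi * of_int k * t) * cis (- (2 * pi * t))"
        by (simp_all add: cis_mult algebra_simps)
      then show ?thesis by (simp add: s[of t] algebra_simps)
    qed
    have "(LINT t:{0..1}|lborel. D t * s t ^ Suc n * cis (2 * pi * of_int k * t)) =
      1 / 2 * (LINT t:{0..1}|lborel. ?h k t) - (1 / 4 * (LINT t:{0..1}|lborel. ?h (k + 1) t) + 1 / 4 * (LINT t:{0..1}|lborel. ?h (k - 1) t))"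
      unfolding eq set_integral_diff(2)[OF i set_integral_add(1)[OF i i]] set_integral_add(2)[OF i i]
        set_integral_mult_right ..
    then show ?case unfolding Suc.IH by simp
  qed
  \<comment> \<open>Rotated so that the value at the midpoint becomes positive.\<close>
  define u where "u t = Re (D t * cnj (D (1 / 2)))" for t
  have u: "continuous_on {0..1} u"
    unfolding u_def by (intro continuous_intros D)
  define u0 where "u0 = u (1 / 2)"
  have u0: "u0 > 0" using nz by (simp add: u0_def u_def flip: complex_norm_square)
  have zero_u: "(LINT t:{0..1}|lborel. u t * sin (pi * t) ^ (2 * n)) = 0" for n
  proof -
    let ?h = "\<lambda>t. cnj (D (1 / 2)) * (D t * s t ^ n)"
    have "set_integrable lborel {0..1} ?h" unfolding s_def by (intro int continuous_intros D)
    then have "(LINT t:{0..1}|lborel. Re (?h t)) = Re (LINT t:{0..1}|lborel. ?h t)"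
      unfolding set_lebesgue_integral_def set_integrable_def by (subst integral_Re[symmetric]) auto
    also have "\<dots> = 0" using trig[of n 0] by simp
    also have "(\<lambda>t. Re (?h t)) = (\<lambda>t. u t * sin (pi * t) ^ (2 * n))"
      unfolding s_def u_def power_mult of_real_power[symmetric] by (simp add: fun_eq_iff algebra_simps)
    finally show ?thesis .
  qed
  have "continuous_on {0..1} (\<lambda>t. \<bar>u t\<bar>)" by (intro continuous_intros u)
  then obtain M where M: "\<And>t. t \<in> {0..1} \<Longrightarrow> \<bar>u t\<bar> \<le> M"
    using continuous_attains_sup[of "{0..1 :: real}" "\<lambda>t. \<bar>u t\<bar>"] by fastforce
  have "\<exists>\<delta>>0. \<forall>t\<in>{0..1}. \<bar>t - 1 / 2\<bar> < \<delta> \<longrightarrow> \<bar>u t - u0\<bar> < u0 / 2"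
    using u[unfolded continuous_on_iff, rule_format, of "1 / 2" "u0 / 2"] u0
    by (auto simp: dist_real_def u0_def)
  then obtain \<delta>' where \<delta>': "\<delta>' > 0" "\<And>t. t \<in> {0..1} \<Longrightarrow> \<bar>t - 1 / 2\<bar> < \<delta>' \<Longrightarrow> \<bar>u t - u0\<bar> < u0 / 2"
    by blast
  define \<delta> where "\<delta> = min (\<delta>' / 2) (1 / 2)"
  have \<delta>: "\<delta> > 0" "\<delta> \<le> 1 / 2" "\<And>t. t \<in> {0..1} \<Longrightarrow> \<bar>t - 1 / 2\<bar> \<le> \<delta> \<Longrightarrow> u0 / 2 \<le> u t"
  proof -
    show "\<delta> > 0" "\<delta> \<le> 1 / 2" using \<delta>'(1) by (auto simp: \<delta>_def)
    have "\<delta> < \<delta>'" using \<delta>'(1) by (auto simp: \<delta>_def min_def)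
    fix t :: real assume t: "t \<in> {0..1}" "\<bar>t - 1 / 2\<bar> \<le> \<delta>"
    have "\<bar>u t - u0\<bar> < u0 / 2" using t \<open>\<delta> < \<delta>'\<close> by (intro \<delta>'(2)) auto
    then show "u0 / 2 \<le> u t" using abs_ge_minus_self[of "u t - u0"] by linarith
  qed
  \<comment> \<open>On the half-size interval the kernel is at least \<open>c1\<^sup>2\<^sup>n\<close>, and outside the full one at most \<open>c2\<^sup>2\<^sup>n\<close>; in between its sign suffices.\<close>
  define c1 c2 where "c1 = cos (pi * \<delta> / 2)" and "c2 = cos (pi * \<delta>)"
  have sin_cos: "sin (pi * t) = cos (pi * \<bar>t - 1 / 2\<bar>)" for t
  proof -
    have "sin (pi * t) = cos (pi / 2 - pi * t)" by (simp add: sin_cos_eq)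
    also have "pi / 2 - pi * t = - (pi * (t - 1 / 2))" by (simp add: algebra_simps)
    finally show ?thesis by (simp add: abs_if) (metis cos_minus minus_diff_eq mult_minus_right)
  qed
  have pd: "0 < pi * \<delta>" "pi * \<delta> \<le> pi * (1 / 2)"
    using \<delta> by (auto intro!: mult_left_mono simp del: mult_le_cancel_left_pos)
  have c: "0 \<le> c2" "c2 < c1"
    unfolding c1_def c2_def using pd pi_gt_zero
    by - (rule cos_ge_zero cos_monotone_0_pi; linarith)+
  have point: "u0 / 2 * c1 ^ (2 * n) * indicator {1 / 2 - \<delta> / 2..1 / 2 + \<delta> / 2} t - M * c2 ^ (2 * n)
      \<le> u t * sin (pi * t) ^ (2 * n)" if t: "t \<in> {0..1}" for n t
  proof -
    have M0: "0 \<le> M" using M[OF t] by linarith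
    have ev: "0 \<le> sin (pi * t) ^ (2 * n)" by simp
    consider "\<bar>t - 1 / 2\<bar> \<le> \<delta> / 2" | "\<delta> / 2 < \<bar>t - 1 / 2\<bar>" "\<bar>t - 1 / 2\<bar> \<le> \<delta>" | "\<delta> < \<bar>t - 1 / 2\<bar>"
      by linarith
    then show ?thesis
    proof cases
      case 1
      have "pi * \<bar>t - 1 / 2\<bar> \<le> pi * (\<delta> / 2)" using 1 by (intro mult_left_mono) auto
      then have "c1 \<le> sin (pi * t)"
        unfolding c1_def sin_cos using \<delta> by (intro cos_monotone_0_pi_le) auto
      then have "c1 ^ (2 * n) \<le> sin (pi * t) ^ (2 * n)" using c by (intro power_mono) auto
      then have "u0 / 2 * c1 ^ (2 * n) \<le> u t * sin (pi * t) ^ (2 * n)"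
        using \<delta>(3)[OF t] 1 \<delta>(1) u0 c by (intro mult_mono) auto
      moreover have "0 \<le> M * c2 ^ (2 * n)" using M0 by simp
      moreover have "indicator {1 / 2 - \<delta> / 2..1 / 2 + \<delta> / 2} t \<le> (1 :: real)" by (simp add: indicator_def)
      then have "u0 / 2 * c1 ^ (2 * n) * indicator {1 / 2 - \<delta> / 2..1 / 2 + \<delta> / 2} t \<le> u0 / 2 * c1 ^ (2 * n)"
        using u0 c by (intro mult_left_le) auto
      ultimately show ?thesis by linarith
    next
      case 2
      then have "t \<notin> {1 / 2 - \<delta> / 2..1 / 2 + \<delta> / 2}" unfolding atLeastAtMost_iff by linarith
      then have "indicator {1 / 2 - \<delta> / 2..1 / 2 + \<delta> / 2} t = (0 :: real)" by simp
      moreover have "0 \<le> u t * sin (pi * t) ^ (2 * n)"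
        using \<delta>(3)[OF t 2(2)] u0 ev by (intro mult_nonneg_nonneg) auto
      moreover have "0 \<le> M * c2 ^ (2 * n)" using M0 by simp
      ultimately show ?thesis by (simp only: mult_zero_right)
    next
      case 3
      then have "t \<notin> {1 / 2 - \<delta> / 2..1 / 2 + \<delta> / 2}" using \<delta>(1) unfolding atLeastAtMost_iff by linarith
      then have "indicator {1 / 2 - \<delta> / 2..1 / 2 + \<delta> / 2} t = (0 :: real)" by simp
      moreover have "- (M * c2 ^ (2 * n)) \<le> u t * sin (pi * t) ^ (2 * n)"
      proof -
        have ab: "\<bar>t - 1 / 2\<bar> \<le> 1 / 2" using t by (auto simp: abs_if)
        have "pi * \<delta> \<le> pi * \<bar>t - 1 / 2\<bar>" "pi * \<bar>t - 1 / 2\<bar> \<le> pi * (1 / 2)"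
          using 3 ab by (auto intro!: mult_left_mono)
        then have "sin (pi * t) \<le> c2" "0 \<le> sin (pi * t)"
          unfolding c2_def sin_cos using pd pi_gt_zero
          by - (rule cos_monotone_0_pi_le cos_ge_zero; linarith)+
        then have "sin (pi * t) ^ (2 * n) \<le> c2 ^ (2 * n)" by (intro power_mono) auto
        then have "\<bar>u t\<bar> * sin (pi * t) ^ (2 * n) \<le> M * c2 ^ (2 * n)"
          using M[OF t] M0 by (intro mult_mono) auto
        moreover have "- (\<bar>u t\<bar> * sin (pi * t) ^ (2 * n)) \<le> u t * sin (pi * t) ^ (2 * n)"
          using mult_right_mono[OF abs_ge_minus_self[of "u t"] ev] by linarith
        ultimately show ?thesis by linarith
      qed
      ultimately show ?thesis by (simp only: mult_zero_right)
    qed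
  qed
  have bound: "u0 / 2 * \<delta> * c1 ^ (2 * n) \<le> M * c2 ^ (2 * n)" for n
  proof -
    let ?J = "{1 / 2 - \<delta> / 2..1 / 2 + \<delta> / 2}"
    have eq: "indicator {0..1} t *\<^sub>R (u0 / 2 * c1 ^ (2 * n) * indicator ?J t - M * c2 ^ (2 * n)) =
        u0 / 2 * c1 ^ (2 * n) * indicator ?J t - M * c2 ^ (2 * n) * indicator {0..1} t" for t :: real
      using \<delta>(2) by (auto simp: indicator_def)
    have "(LINT t:{0..1}|lborel. u0 / 2 * c1 ^ (2 * n) * indicator ?J t - M * c2 ^ (2 * n)) \<le> (LINT t:{0..1}|lborel. u t * sin (pi * t) ^ (2 * n))"
    proof (rule set_integral_mono)
      show "set_integrable lborel {0..1} (\<lambda>t. u t * sin (pi * t) ^ (2 * n))"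
        by (intro borel_integrable_atLeastAtMost' continuous_intros u)
      show "set_integrable lborel {0..1} (\<lambda>t. u0 / 2 * c1 ^ (2 * n) * indicator ?J t - M * c2 ^ (2 * n))"
        unfolding set_integrable_def eq
        by (intro Bochner_Integration.integrable_diff integrable_mult_right integrable_real_indicator)
           (use \<delta>(1) in simp_all)
    qed (rule point)
    also have "\<dots> = 0" by (rule zero_u)
    also have "(LINT t:{0..1}|lborel. u0 / 2 * c1 ^ (2 * n) * indicator ?J t - M * c2 ^ (2 * n)) =
        (LINT t|lborel. u0 / 2 * c1 ^ (2 * n) * indicator ?J t - M * c2 ^ (2 * n) * indicator {0..1} t)"
      unfolding set_lebesgue_integral_def eq ..
    also have "\<dots> = u0 / 2 * c1 ^ (2 * n) * \<delta> - M * c2 ^ (2 * n)"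
      using \<delta>(1) by (subst Bochner_Integration.integral_diff) (simp_all add: integrable_mult_right)
    finally show ?thesis by (simp add: mult_ac)
  qed
  have "(\<lambda>n. (c2 / c1) ^ (2 * n)) \<longlonglongrightarrow> 0"
    unfolding power_mult using c by (intro LIMSEQ_power_zero) (simp add: power_divide power_strict_mono divide_less_eq)
  then have "(\<lambda>n. M * (c2 / c1) ^ (2 * n)) \<longlonglongrightarrow> 0" by (rule tendsto_mult_right_zero)
  then have "\<forall>\<^sub>F n in sequentially. M * (c2 / c1) ^ (2 * n) < u0 / 2 * \<delta>"
    using u0 \<delta> by (intro order_tendstoD) auto
  then obtain n where "M * (c2 / c1) ^ (2 * n) < u0 / 2 * \<delta>"
    by (auto simp: eventually_sequentially)
  moreover have "c1 ^ (2 * n) > 0" using c by simp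
  ultimately have "M * c2 ^ (2 * n) < u0 / 2 * \<delta> * c1 ^ (2 * n)"
    by (simp add: power_divide field_simps)
  with bound[of n] show False by linarith
qed

lemma abs_summable_times:
  fixes a :: "'i \<Rightarrow> 'c :: real_normed_div_algebra" and b :: "'j \<Rightarrow> 'c"
  assumes a: "(\<lambda>i. norm (a i)) summable_on A" and b: "(\<lambda>j. norm (b j)) summable_on B"
  shows "(\<lambda>(i, j). norm (a i * b j)) summable_on (A \<times> B)"
proof -
  have "(\<lambda>p. norm (a (fst p) * b (snd p))) summable_on (A \<times> B)"
    unfolding Infinite_Sum.abs_summable_on_Sigma_iff
  proof (intro conjI ballI)
    show "(\<lambda>j. norm (a (fst (i, j)) * b (snd (i, j)))) summable_on B" for i
      using summable_on_cmult_right[OF b, of "norm (a i)"] by (simp add: norm_mult)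
    have "(\<lambda>i. norm (a i) * infsum (\<lambda>j. norm (b j)) B) summable_on A"
      by (rule summable_on_cmult_left[OF a])
    then show "(\<lambda>i. norm (\<Sum>\<^sub>\<infinity>j\<in>B. norm (a (fst (i, j)) * b (snd (i, j))))) summable_on A"
      by (simp add: norm_mult infsum_cmult_right' abs_mult infsum_nonneg)
  qed
  then show ?thesis by (simp add: case_prod_unfold)
qed

lemma has_sum_finite_sum:
  fixes f :: "'i \<Rightarrow> 'j \<Rightarrow> complex"
  assumes "finite I" "\<And>i. i \<in> I \<Longrightarrow> (f i has_sum s i) A"
  shows "((\<lambda>x. \<Sum>i\<in>I. f i x) has_sum (\<Sum>i\<in>I. s i)) A"
  using assms by (induction I rule: finite_induct) (auto intro: has_sum_add)

lemma infsum_times: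
  fixes a :: "'i \<Rightarrow> complex" and b :: "'j \<Rightarrow> complex"
  assumes a: "(\<lambda>i. norm (a i)) summable_on A" and b: "(\<lambda>j. norm (b j)) summable_on B"
  shows "(\<Sum>\<^sub>\<infinity>(i, j)\<in>A \<times> B. a i * b j) = infsum a A * infsum b B"
proof -
  have "(\<lambda>(i, j). a i * b j) summable_on (A \<times> B)"
    using abs_summable_times[OF a b] by - (rule Infinite_Sum.abs_summable_summable, simp add: case_prod_unfold)
  from infsum_Sigma'_banach[OF this] show ?thesis
    by (simp add: infsum_cmult_right' infsum_cmult_left')
qed

lemma amalgam_bound_translate:
  assumes "amalgam_bound B f"
  shows "\<exists>B'. amalgam_bound B' (\<lambda>t. f (t + \<tau>))"
proof (intro exI)
  let ?m = "\<lfloor>\<tau>\<rfloor>"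
  have s: "B summable_on UNIV" using assms by (simp add: amalgam_bound_def)
  show "amalgam_bound (\<lambda>k. B (?m + k) + B ((?m + 1) + k)) (\<lambda>t. f (t + \<tau>))"
    unfolding amalgam_bound_def
  proof (intro conjI allI)
    show "(\<lambda>k. B (?m + k) + B ((?m + 1) + k)) summable_on UNIV"
      by (intro summable_on_add summable_on_shift_int s)
    fix t
    have "norm (f (t + \<tau>)) \<le> B \<lfloor>t + \<tau>\<rfloor>" using assms by (simp add: amalgam_bound_def)
    moreover have "\<lfloor>t + \<tau>\<rfloor> = ?m + \<lfloor>t\<rfloor> \<or> \<lfloor>t + \<tau>\<rfloor> = (?m + 1) + \<lfloor>t\<rfloor>" by linarith
    ultimately show "norm (f (t + \<tau>)) \<le> B (?m + \<lfloor>t\<rfloor>) + B ((?m + 1) + \<lfloor>t\<rfloor>)"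
      using amalgam_bound_nonneg[OF assms, of "?m + \<lfloor>t\<rfloor>"] amalgam_bound_nonneg[OF assms, of "(?m + 1) + \<lfloor>t\<rfloor>"]
      by auto
  qed
qed

lemma amalgam_bound_cis:
  "amalgam_bound B f \<Longrightarrow> amalgam_bound B (\<lambda>t. f t * cis (r * t))"
  by (simp add: amalgam_bound_def norm_mult)

text \<open>
  Both sides are continuous functions of the evaluation point with the same Fourier coefficients.
  The summability of the coefficients makes the right-hand side continuous, and allows its own
  coefficients to be computed term by term.
\<close>
lemma poisson_summation_midpoint:
  assumes cont: "continuous_on UNIV F" and B: "amalgam_bound B F"
    and a: "\<And>k :: int. a k = (LINT t|lborel. F t * cis (2 * pi * of_int k * t))"
    and s: "(\<lambda>k. norm (a k)) summable_on UNIV"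
  shows "(\<Sum>\<^sub>\<infinity>j :: int. F (1 / 2 + of_int j)) = (\<Sum>\<^sub>\<infinity>k :: int. a k * cis (- (pi * of_int k)))"
proof -
  define P where "P t = (\<Sum>\<^sub>\<infinity>j :: int. F (t + of_int j))" for t
  define Q where "Q t = (\<Sum>\<^sub>\<infinity>k :: int. a k * cis (- (2 * pi * of_int k * t)))" for t
  have P: "continuous_on {0..1} P" unfolding P_def
  proof (rule continuous_on_infsum_uniform)
    show "norm (F (t + of_int k)) \<le> B (k - 1) + B k + B (k + 1)" if "t \<in> {0..1}" for t and k :: int
      using amalgam_uniform_bound(2)[OF B, of t k] that by simp
    show "continuous_on {0..1} (\<lambda>t. F (t + of_int k))" for k :: int
      by (rule continuous_on_compose2[OF cont]) (auto intro!: continuous_intros)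
  qed (rule amalgam_uniform_bound(1)[OF B])
  have Q: "continuous_on {0..1} Q" unfolding Q_def
    by (rule continuous_on_infsum_uniform[where C = "\<lambda>k. norm (a k)"])
       (auto intro!: continuous_intros s simp: norm_mult)
  have Fm[measurable]: "F \<in> borel_measurable borel" by (rule borel_measurable_continuous_onI[OF cont])
  have intP: "(LINT t:{0..1}|lborel. P t * cis (2 * pi * of_int m * t)) = a m" for m :: int
  proof -
    have "P t * cis (2 * pi * of_int m * t) = (\<Sum>\<^sub>\<infinity>j :: int. F (t + of_int j) * cis (2 * pi * of_int m * (t + of_int j)))" for t
    proof -
      have "cis (2 * pi * of_int m * (t + of_int j)) = cis (2 * pi * of_int m * t)" for j :: int
      proof -
        have "cis (2 * pi * of_int m * (t + of_int j)) = cis (2 * pi * of_int m * t) * cis (2 * pi * of_int (m * j))"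
          by (simp add: cis_mult algebra_simps)
        also have "cis (2 * pi * of_int (m * j)) = 1" by (rule cis_multiple_2pi) (rule Ints_of_int)
        finally show ?thesis by simp
      qed
      then show ?thesis unfolding P_def by (simp add: infsum_cmult_left')
    qed
    then have "(LINT t:{0..1}|lborel. P t * cis (2 * pi * of_int m * t)) =
      (LINT t:{0..1}|lborel. (\<Sum>\<^sub>\<infinity>j :: int. F (t + of_int j) * cis (2 * pi * of_int m * (t + of_int j))))"
      by simp
    also have "\<dots> = (LINT t|lborel. F t * cis (2 * pi * of_int m * t))"
      by (rule amalgam_integral_periodization[OF amalgam_bound_cis[OF B]]) measurable
    finally show ?thesis by (simp add: a)
  qed
  have intQ: "(LINT t:{0..1}|lborel. Q t * cis (2 * pi * of_int m * t)) = a m" for m :: int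
  proof -
    let ?q = "\<lambda>k t. a k * cis (- (2 * pi * of_int k * t)) * cis (2 * pi * of_int m * t)"
    have "Q t * cis (2 * pi * of_int m * t) = (\<Sum>\<^sub>\<infinity>k :: int. ?q k t)" for t
      unfolding Q_def by (rule infsum_cmult_left'[symmetric])
    then have "(LINT t:{0..1}|lborel. Q t * cis (2 * pi * of_int m * t)) = (LINT t:{0..1}|lborel. (\<Sum>\<^sub>\<infinity>k :: int. ?q k t))"
      by simp
    moreover have "((\<lambda>k :: int. LINT t:{0..1}|lborel. ?q k t) has_sum (LINT t:{0..1}|lborel. (\<Sum>\<^sub>\<infinity>k :: int. ?q k t))) UNIV"
      by (rule has_sum_set_integral_uniform(2)[OF _ infinite_UNIV_int, where C = "\<lambda>k. norm (a k)"])
         (use s in \<open>simp_all add: norm_mult\<close>)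
    moreover have "(LINT t:{0..1}|lborel. ?q k t) = (if k = m then a m else 0)" for k
    proof -
      have eq: "?q k t = a k * cis (2 * pi * of_int (m - k) * t)" for t
        by (simp add: mult.assoc cis_mult algebra_simps)
      have "(LINT t:{0..1}|lborel. ?q k t) = a k * (LINT t:{0..1}|lborel. cis (2 * pi * of_int (m - k) * t))"
        unfolding eq set_integral_mult_right ..
      then show ?thesis using set_integral_cis[of 1 "m - k" "of_int (m - k)"] by auto
    qed
    moreover have "((\<lambda>k. if k = m then a m else 0) has_sum a m) UNIV"
    proof -
      have "((\<lambda>k. if k = m then a m else 0) has_sum a m) {m}" by (simp add: has_sum_finite_iff)
      moreover have "((\<lambda>k. if k = m then a m else 0) has_sum a m) {m} \<longleftrightarrow> ((\<lambda>k. if k = m then a m else 0) has_sum a m) UNIV"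
        by (rule has_sum_cong_neutral) auto
      ultimately show ?thesis by simp
    qed
    ultimately show ?thesis by (simp add: has_sum_unique)
  qed
  have "P (1 / 2) - Q (1 / 2) = 0"
  proof (rule fourier_uniqueness_midpoint)
    show "continuous_on {0..1} (\<lambda>t. P t - Q t)" by (intro continuous_intros P Q)
    fix k :: int
    have iP: "set_integrable lborel {0..1} (\<lambda>t. P t * cis (2 * pi * of_int k * t))"
      and iQ: "set_integrable lborel {0..1} (\<lambda>t. Q t * cis (2 * pi * of_int k * t))"
      by (intro borel_integrable_atLeastAtMost' continuous_intros P Q)+
    show "(LINT t:{0..1}|lborel. (P t - Q t) * cis (2 * pi * of_int k * t)) = 0"
      unfolding left_diff_distrib set_integral_diff(2)[OF iP iQ] intP intQ by simp
  qed
  then show ?thesis by (simp add: P_def Q_def)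
qed

text \<open>
  Translating \<open>F\<close> moves an arbitrary point to the midpoint.
\<close>
theorem poisson_summation:
  assumes cont: "continuous_on UNIV F" and B: "amalgam_bound B F"
    and a: "\<And>k :: int. a k = (LINT t|lborel. F t * cis (2 * pi * of_int k * t))"
    and s: "(\<lambda>k. norm (a k)) summable_on UNIV"
  shows "(\<Sum>\<^sub>\<infinity>j :: int. F (t + of_int j)) = (\<Sum>\<^sub>\<infinity>k :: int. a k * cis (- (2 * pi * of_int k * t)))"
proof -
  define \<tau> where "\<tau> = t - 1 / 2"
  obtain B' where B': "amalgam_bound B' (\<lambda>t. F (t + \<tau>))"
    using amalgam_bound_translate[OF B] by blast
  define b where "b k = a k * cis (- (2 * pi * of_int k * \<tau>))" for k :: int
  have b: "b k = (LINT t|lborel. F (t + \<tau>) * cis (2 * pi * of_int k * t))" for k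
  proof -
    have "a k = (LINT t|lborel. F (\<tau> + 1 * t) * cis (2 * pi * of_int k * (\<tau> + 1 * t)))"
      unfolding a by (subst lborel_integral_real_affine[of 1 _ \<tau>]) simp_all
    also have "\<dots> = (LINT t|lborel. cis (2 * pi * of_int k * \<tau>) * (F (t + \<tau>) * cis (2 * pi * of_int k * t)))"
      by (rule Bochner_Integration.integral_cong[OF refl]) (simp add: cis_mult[symmetric] distrib_left add.commute)
    finally have "a k = cis (2 * pi * of_int k * \<tau>) * (LINT t|lborel. F (t + \<tau>) * cis (2 * pi * of_int k * t))"
      by simp
    then show ?thesis
      by (simp add: b_def cis_mult algebra_simps)
  qed
  have "(\<Sum>\<^sub>\<infinity>j :: int. F ((1 / 2 + of_int j) + \<tau>)) = (\<Sum>\<^sub>\<infinity>k :: int. b k * cis (- (pi * of_int k)))"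
  proof (rule poisson_summation_midpoint[OF _ B' b])
    show "continuous_on UNIV (\<lambda>t. F (t + \<tau>))"
      by (rule continuous_on_compose2[OF cont]) (auto intro!: continuous_intros)
    show "(\<lambda>k. norm (b k)) summable_on UNIV" using s by (simp add: b_def norm_mult)
  qed
  also have "(\<lambda>k. b k * cis (- (pi * of_int k))) = (\<lambda>k. a k * cis (- (2 * pi * of_int k * t)))"
    by (simp add: fun_eq_iff b_def \<tau>_def mult.assoc cis_mult algebra_simps)
  finally show ?thesis by (simp add: \<tau>_def algebra_simps)
qed

section \<open>Double periodizations as combinations of delta trains\<close>

lemma sum_roots_of_unity:
  fixes k :: int
  assumes "N \<ge> 1"
  shows "(\<Sum>n<N. cis (- (2 * pi * of_int k * (real n / real N)))) = (if int N dvd k then of_nat N else 0)"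
proof -
  define z where "z = cis (- (2 * pi * of_int k / real N))"
  have pow: "cis (- (2 * pi * of_int k * (real n / real N))) = z ^ n" for n
  proof -
    have "- (2 * pi * of_int k * (real n / real N)) = real n * (- (2 * pi * of_int k / real N))" by simp
    then show ?thesis unfolding z_def Complex.DeMoivre by (rule arg_cong)
  qed
  have zN: "z ^ N = 1"
  proof -
    have "z ^ N = cis (2 * pi * of_int (- k))" using assms by (simp add: z_def Complex.DeMoivre)
    also have "\<dots> = 1" by (rule cis_multiple_2pi) (rule Ints_of_int)
    finally show ?thesis .
  qed
  show ?thesis
  proof (cases "int N dvd k")
    case True
    then obtain m where "k = int N * m" by blast
    then have "z = cis (2 * pi * of_int (- m))" using assms by (simp add: z_def field_simps)
    also have "\<dots> = 1" by (rule cis_multiple_2pi) (rule Ints_of_int)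
    finally show ?thesis unfolding pow using True by simp
  next
    case False
    have "z \<noteq> 1"
    proof
      assume "z = 1"
      then have "cos (2 * pi * of_int k / real N) = 1" by (simp add: z_def complex_eq_iff)
      then obtain m :: int where "2 * pi * of_int k / real N = of_int m * (2 * pi)"
        by (auto simp: cos_one_2pi_int)
      then have "real_of_int k = of_int (m * int N)" using assms by (simp add: field_simps)
      then show False using False by (simp only: of_int_eq_iff) simp
    qed
    then show ?thesis unfolding pow using False geometric_sum[of z N] zN by simp
  qed
qed

definition periodization :: "(real \<Rightarrow> complex) \<Rightarrow> real \<Rightarrow> complex" where
  "periodization f t = (\<Sum>\<^sub>\<infinity>k :: int. f (t + of_int k))"

lemma feichtinger_samples_summable:
  assumes "f \<in> feichtinger"
  shows "(\<lambda>k :: int. norm (f (t + of_int k))) summable_on UNIV"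
  by (rule feichtinger_amalgam[OF assms]) (rule amalgam_summable)

lemma delta_train_eq:
  "delta_train N n h = (if h \<in> feichtinger then cnj (periodization h (real n / real N)) else 0)"
  by (simp add: delta_train_def delta_def periodization_def)

lemma amalgam_bound_mult_bounded:
  assumes B: "amalgam_bound B f" and g: "amalgam_bound C g"
  shows "\<exists>K. amalgam_bound (\<lambda>k. K * B k) (\<lambda>t. cnj (g t) * f t)"
proof -
  let ?K = "infsum C UNIV"
  have Cs: "C summable_on UNIV" using g by (simp add: amalgam_bound_def)
  have "norm (g t) \<le> ?K" for t
  proof -
    have "norm (g t) \<le> C \<lfloor>t\<rfloor>" using g by (simp add: amalgam_bound_def)
    also have "\<dots> = sum C {\<lfloor>t\<rfloor>}" by simp
    also have "\<dots> \<le> ?K" using amalgam_bound_nonneg[OF g] by (intro finite_sum_le_infsum Cs) auto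
    finally show ?thesis .
  qed
  then have "norm (cnj (g t) * f t) \<le> ?K * B \<lfloor>t\<rfloor>" for t
    using B amalgam_bound_nonneg[OF B] unfolding norm_mult amalgam_bound_def complex_mod_cnj
    by (intro mult_mono) (auto intro: order_trans[OF norm_ge_zero])
  then show ?thesis
    using B unfolding amalgam_bound_def by (intro exI[of _ ?K]) (auto intro: summable_on_cmult_right)
qed

text \<open>
  Sampling the coefficients at the multiples of \<open>N\<close> is averaging the Poisson formula over the \<open>N\<close>
  points \<open>n / N\<close>, because the average of the characters is the indicator of divisibility by \<open>N\<close>.
\<close>
lemma sum_modulations_eq_sum_samples:
  assumes f: "f \<in> feichtinger" and h: "h \<in> feichtinger" and N: "N \<ge> 1"
    and s: "(\<lambda>k :: int. norm (L2_inner (tf_shift x (of_int k) f) h)) summable_on UNIV"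
  shows "(\<Sum>\<^sub>\<infinity>k :: int. L2_inner (tf_shift x (real N * of_int k) f) h) =
    (\<Sum>n<N. \<Sum>\<^sub>\<infinity>j :: int. f (real n / real N + of_int j - x) * cnj (h (real n / real N + of_int j))) / of_nat N"
proof -
  define F where "F t = f (t - x) * cnj (h t)" for t
  define a where "a k = L2_inner (tf_shift x (of_int k) f) h" for k :: int
  have a: "a k = (LINT t|lborel. F t * cis (2 * pi * of_int k * t))" for k
    by (simp add: a_def F_def L2_inner_def tf_shift_def modulation_def translation_def mult_ac)
  have as: "(\<lambda>k. norm (a k)) summable_on UNIV" using s by (simp add: a_def)
  have as': "(\<lambda>k. a k * cis (r k)) summable_on UNIV" for r
    by (rule Infinite_Sum.abs_summable_summable) (use as in \<open>simp add: norm_mult\<close>)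
  obtain Bf where Bf: "amalgam_bound Bf f" by (rule feichtinger_amalgam[OF f])
  obtain Bh where Bh: "amalgam_bound Bh h" by (rule feichtinger_amalgam[OF h])
  obtain Bx where Bx: "amalgam_bound Bx (\<lambda>t. f (t + - x))" using amalgam_bound_translate[OF Bf] by blast
  obtain K where K: "amalgam_bound (\<lambda>k. K * Bx k) (\<lambda>t. cnj (h t) * f (t + - x))"
    using amalgam_bound_mult_bounded[OF Bx Bh] by blast
  have BF: "amalgam_bound (\<lambda>k. K * Bx k) F"
  proof -
    have "F = (\<lambda>t. cnj (h t) * f (t + - x))" by (simp add: fun_eq_iff F_def)
    with K show ?thesis by simp
  qed
  have cont: "continuous_on UNIV F" unfolding F_def
    by (intro continuous_intros continuous_on_compose2[OF feichtingerD(3)[OF f]] feichtingerD(3)[OF h]) auto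
  have P: "(\<Sum>\<^sub>\<infinity>j :: int. F (t + of_int j)) = (\<Sum>\<^sub>\<infinity>k :: int. a k * cis (- (2 * pi * of_int k * t)))" for t
    by (rule poisson_summation[OF cont BF a as])
  have "(\<Sum>n<N. \<Sum>\<^sub>\<infinity>j :: int. F (real n / real N + of_int j)) =
      (\<Sum>n<N. \<Sum>\<^sub>\<infinity>k :: int. a k * cis (- (2 * pi * of_int k * (real n / real N))))"
    unfolding P ..
  also have "\<dots> = (\<Sum>\<^sub>\<infinity>k :: int. (\<Sum>n<N. a k * cis (- (2 * pi * of_int k * (real n / real N)))))"
    by (rule infsumI[symmetric], rule has_sum_finite_sum) (simp_all add: as')
  also have "\<dots> = (\<Sum>\<^sub>\<infinity>k :: int. a k * (if int N dvd k then of_nat N else 0))"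
    unfolding sum_distrib_left[symmetric] sum_roots_of_unity[OF N] ..
  also have "\<dots> = (\<Sum>\<^sub>\<infinity>k\<in>range (\<lambda>k. int N * k). a k * of_nat N)"
    by (rule infsum_cong_neutral) auto
  also have "\<dots> = (\<Sum>\<^sub>\<infinity>k. a (int N * k)) * of_nat N"
    using N by (subst infsum_reindex) (auto simp: inj_on_def o_def infsum_cmult_left')
  finally show ?thesis
    using N by (simp add: a_def F_def)
qed

text \<open>
  In other words \<open>\<Sigma>\<^sub>N f\<close> is the combination of the delta trains \<open>\<epsilon>\<^sub>n\<close> with the coefficients
  \<open>(1/N) \<Sum>k. f(n/N + k)\<close>.  The sum over modulations is Poisson summation for the product of the
  translate of \<open>f\<close> with the conjugate of \<open>h\<close>; the sum over translations then separates the samples of \<open>f\<close> from those of \<open>h\<close>.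
\<close>
theorem double_periodization_eq:
  assumes f: "f \<in> feichtinger" and h: "h \<in> feichtinger" and N: "N \<ge> 1"
  shows "double_periodization N f h =
    (\<Sum>n<N. periodization f (real n / real N) * cnj (periodization h (real n / real N))) / of_nat N"
proof -
  define A where "A k l = L2_inner (tf_shift (of_int k) (of_int l) f) h" for k l :: int
  have A: "(\<lambda>(k, l). norm (A k l)) summable_on UNIV"
    using feichtinger_lattice_summable[OF h f] unfolding A_def by (subst norm_L2_inner_commute)
  have A1: "(\<lambda>l. norm (A k l)) summable_on UNIV" for k
  proof -
    have "(\<lambda>(k, l). norm (A k l)) summable_on (Pair k ` UNIV)"
      by (rule summable_on_subset_banach[OF A]) simp
    then show ?thesis by (subst (asm) summable_on_reindex) (auto simp: inj_on_def o_def)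
  qed
  have A2: "(\<lambda>(k, l). A k (int N * l)) summable_on (UNIV \<times> UNIV)"
  proof -
    have "(\<lambda>(k, l). norm (A k l)) summable_on range (\<lambda>(k, l). (k, int N * l))"
      by (rule summable_on_subset_banach[OF A]) simp
    moreover have "inj (\<lambda>(k :: int, l). (k, int N * l))"
      using N by (auto simp: inj_on_def)
    ultimately have "((\<lambda>(k, l). norm (A k l)) \<circ> (\<lambda>(k, l). (k, int N * l))) summable_on UNIV"
      using summable_on_reindex by blast
    then have "(\<lambda>(k, l). norm (A k (int N * l))) summable_on UNIV"
      by (simp add: o_def case_prod_unfold)
    then show ?thesis by - (rule Infinite_Sum.abs_summable_summable, simp add: case_prod_unfold)
  qed
  let ?y = "\<lambda>n. real n / real N"
  have "double_periodization N f h = (\<Sum>\<^sub>\<infinity>(k, l)\<in>UNIV \<times> UNIV. A k (int N * l))"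
    using h by (simp add: double_periodization_def functional_of_def A_def tf_shift_def)
  also have "\<dots> = (\<Sum>\<^sub>\<infinity>k. \<Sum>\<^sub>\<infinity>l. A k (int N * l))"
    by (rule infsum_Sigma'_banach[OF A2, symmetric])
  also have "\<dots> = (\<Sum>\<^sub>\<infinity>k :: int. (\<Sum>n<N. \<Sum>\<^sub>\<infinity>j :: int. f (?y n + of_int j - of_int k) * cnj (h (?y n + of_int j))) / of_nat N)"
    unfolding A_def using sum_modulations_eq_sum_samples[OF f h N A1[unfolded A_def]] by simp
  also have "\<dots> = (\<Sum>\<^sub>\<infinity>k :: int. (\<Sum>n<N. \<Sum>\<^sub>\<infinity>j :: int. f (?y n + of_int j - of_int k) * cnj (h (?y n + of_int j)))) / of_nat N"
    unfolding divide_inverse by (rule infsum_cmult_left')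
  also have "(\<Sum>\<^sub>\<infinity>k :: int. (\<Sum>n<N. \<Sum>\<^sub>\<infinity>j :: int. f (?y n + of_int j - of_int k) * cnj (h (?y n + of_int j)))) =
      (\<Sum>n<N. periodization f (?y n) * cnj (periodization h (?y n)))"
  proof (rule infsumI, rule has_sum_finite_sum[OF finite_lessThan])
    fix n
    let ?p = "\<lambda>(m :: int, j :: int). f (?y n + of_int m) * cnj (h (?y n + of_int j))"
    have fs: "(\<lambda>k :: int. norm (f (?y n + of_int k))) summable_on UNIV"
      and hs: "(\<lambda>k :: int. norm (cnj (h (?y n + of_int k)))) summable_on UNIV"
      using feichtinger_samples_summable[OF f] feichtinger_samples_summable[OF h] by auto
    \<comment> \<open>The shear that decouples the two sampling indices.\<close>
    have bij: "bij_betw (\<lambda>(k :: int, j :: int). (j - k, j)) (UNIV \<times> UNIV) (UNIV \<times> UNIV)"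
      by (rule bij_betwI[of _ _ _ "\<lambda>(m, j). (j - m, j)"]) auto
    have "?p summable_on (UNIV \<times> UNIV)"
      using abs_summable_times[OF fs hs] by - (rule Infinite_Sum.abs_summable_summable, simp add: case_prod_unfold)
    then have "(\<lambda>x. ?p (case x of (k, j) \<Rightarrow> (j - k, j))) summable_on (UNIV \<times> UNIV)"
      using summable_on_reindex_bij_betw[OF bij] by blast
    then have S: "(\<lambda>(k :: int, j :: int). f (?y n + of_int j - of_int k) * cnj (h (?y n + of_int j))) summable_on (UNIV \<times> UNIV)"
      by (simp add: case_prod_unfold add_diff_eq)
    have "(\<Sum>\<^sub>\<infinity>k :: int. \<Sum>\<^sub>\<infinity>j :: int. f (?y n + of_int j - of_int k) * cnj (h (?y n + of_int j))) =
       (\<Sum>\<^sub>\<infinity>x\<in>UNIV \<times> UNIV. ?p (case x of (k, j) \<Rightarrow> (j - k, j)))"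
      by (subst infsum_Sigma'_banach[OF S]) (simp add: case_prod_unfold add_diff_eq)
    also have "\<dots> = infsum ?p (UNIV \<times> UNIV)"
      by (rule infsum_reindex_bij_betw[OF bij])
    also have "\<dots> = periodization f (?y n) * cnj (periodization h (?y n))"
      by (subst infsum_times[OF fs hs]) (simp add: periodization_def)
    finally show "((\<lambda>k :: int. \<Sum>\<^sub>\<infinity>j :: int. f (?y n + of_int j - of_int k) * cnj (h (?y n + of_int j))) has_sum
        periodization f (?y n) * cnj (periodization h (?y n))) UNIV"
      using summable_on_Sigma_banach[OF S] by (simp add: has_sum_iff)
  qed
  finally show ?thesis .
qed

section \<open>Orthogonality of Zak transforms on the torus\<close>

text \<open>
  The second argument of the Zak transform is \<open>-\<xi>\<close> because the Zak series runs over \<open>x - k\<close>, the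
  periodization over \<open>x + k\<close>.
\<close>
lemma zak_eq_periodization:
  "cis (2 * pi * \<xi> * t) * zak g (t - x) (- \<xi>) = periodization (tf_shift x \<xi> g) t"
proof -
  have "zak g (t - x) (- \<xi>) = (\<Sum>\<^sub>\<infinity>k :: int. g (t - x + of_int k) * cis (2 * pi * of_int k * \<xi>))"
    unfolding zak_def
    by (rule infsum_reindex_bij_witness[of _ uminus uminus]) auto
  then have "cis (2 * pi * \<xi> * t) * zak g (t - x) (- \<xi>) =
      (\<Sum>\<^sub>\<infinity>k :: int. cis (2 * pi * \<xi> * t) * (g (t - x + of_int k) * cis (2 * pi * of_int k * \<xi>)))"
    by (simp add: infsum_cmult_right')
  also have "\<dots> = periodization (tf_shift x \<xi> g) t"
    unfolding periodization_def
  proof (rule infsum_cong)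
    fix k :: int
    have "cis (2 * pi * \<xi> * (t + of_int k)) = cis (2 * pi * \<xi> * t) * cis (2 * pi * of_int k * \<xi>)"
      by (simp add: cis_mult algebra_simps)
    then show "cis (2 * pi * \<xi> * t) * (g (t - x + of_int k) * cis (2 * pi * of_int k * \<xi>)) = tf_shift x \<xi> g (t + of_int k)"
      by (simp add: tf_shift_def modulation_def translation_def algebra_simps)
  qed
  finally show ?thesis .
qed

lemma integral_torus_tensor:
  fixes u v :: "real \<Rightarrow> complex"
  assumes u: "continuous_on {0..1} u" and v: "continuous_on {0..real N} v"
  shows "(LINT p:torus N|lborel. u (fst p) * v (snd p)) = (LINT x:{0..1}|lborel. u x) * (LINT \<xi>:{0..real N}|lborel. v \<xi>)"
proof -
  let ?u = "\<lambda>x. indicator {0..1} x *\<^sub>R u x" and ?v = "\<lambda>\<xi>. indicator {0..real N} \<xi> *\<^sub>R v \<xi>"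
  have "integrable lborel ?u" "integrable lborel ?v"
    by (intro borel_integrable_compact u v compact_Icc)+
  then have I: "integrable (lborel \<Otimes>\<^sub>M lborel) (\<lambda>(x, \<xi>). ?u x * ?v \<xi>)"
    by (rule integrable_tensor_product)
  have "(LINT p:torus N|lborel. u (fst p) * v (snd p)) = (LINT p|(lborel \<Otimes>\<^sub>M lborel). (case p of (x, \<xi>) \<Rightarrow> ?u x * ?v \<xi>))"
    unfolding set_lebesgue_integral_def lborel_prod
    by (rule Bochner_Integration.integral_cong[OF refl]) (auto simp: torus_def indicator_def)
  also have "\<dots> = (LINT x|lborel. LINT \<xi>|lborel. ?u x * ?v \<xi>)"
    using lborel_pair.integral_fst'[OF I] by simp
  also have "\<dots> = (LINT x|lborel. ?u x) * (LINT \<xi>|lborel. ?v \<xi>)"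
    unfolding integral_mult_right_zero integral_mult_left_zero ..
  finally show ?thesis by (simp add: set_lebesgue_integral_def)
qed

lemma has_sum_diagonal:
  fixes w :: "'i \<Rightarrow> complex"
  assumes "(w has_sum s) UNIV"
  shows "((\<lambda>(k, l). if k = l then w k else 0) has_sum s) (UNIV \<times> UNIV)"
proof -
  have "inj (\<lambda>k :: 'i. (k, k))" by (simp add: inj_on_def)
  from has_sum_reindex[OF this, of "\<lambda>(k, l). w k" s] assms
  have "((\<lambda>(k, l). w k) has_sum s) (range (\<lambda>k. (k, k)))" by (simp add: o_def)
  moreover have "((\<lambda>(k, l). w k) has_sum s) (range (\<lambda>k. (k, k))) \<longleftrightarrow>
      ((\<lambda>(k, l). if k = l then w k else 0) has_sum s) (UNIV \<times> UNIV)"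
    by (rule has_sum_cong_neutral) auto
  ultimately show ?thesis by simp
qed

text \<open>
  As \<open>x\<close> runs through the unit interval and \<open>k\<close> through the integers, \<open>t + k - x\<close> covers the line once.
\<close>
lemma feichtinger_sum_cell_norms:
  assumes g: "g \<in> feichtinger"
  shows "((\<lambda>k :: int. LINT x:{0..1}|lborel. cnj (g (t + of_int k - x)) * g (t + of_int k - x)) has_sum
     complex_of_real ((L2_norm g)\<^sup>2)) UNIV"
proof -
  \<comment> \<open>The offset \<open>t - 1\<close> compensates the reflection \<open>s = 1 - x\<close> of the unit interval.\<close>
  define F where "F s = cnj (g (s + (t - 1))) * g (s + (t - 1))" for s
  obtain B where "amalgam_bound B g" by (rule feichtinger_amalgam[OF g])
  then obtain B' where "amalgam_bound B' (\<lambda>s. g (s + (t - 1)))" using amalgam_bound_translate by blast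
  then obtain K where K: "amalgam_bound (\<lambda>k. K * B' k) F"
    unfolding F_def using amalgam_bound_mult_bounded by blast
  have cont: "continuous_on UNIV F" unfolding F_def
    by (intro continuous_intros continuous_on_compose2[OF feichtingerD(3)[OF g]]) auto
  have "((\<lambda>k :: int. LINT s:{0..1}|lborel. F (s + of_int k)) has_sum (LINT s|lborel. F s)) UNIV"
    by (rule amalgam_integral(2)[OF K borel_measurable_continuous_onI[OF cont]])
  moreover have "(LINT s:{0..1}|lborel. F (s + of_int k)) = (LINT x:{0..1}|lborel. cnj (g (t + of_int k - x)) * g (t + of_int k - x))" for k :: int
  proof -
    have "(LINT s:{0..1}|lborel. F (s + of_int k)) = (LINT x|lborel. indicator {0..1} (1 + (- 1) * x) *\<^sub>R F (1 + (- 1) * x + of_int k))"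
      unfolding set_lebesgue_integral_def by (subst lborel_integral_real_affine[of "-1" _ 1]) simp_all
    also have "\<dots> = (LINT x:{0..1}|lborel. cnj (g (t + of_int k - x)) * g (t + of_int k - x))"
      unfolding set_lebesgue_integral_def
      by (rule Bochner_Integration.integral_cong[OF refl]) (auto simp: F_def indicator_def algebra_simps)
    finally show ?thesis .
  qed
  moreover have "(LINT s|lborel. F s) = complex_of_real ((L2_norm g)\<^sup>2)"
  proof -
    have "(LINT s|lborel. F s) = (LINT s|lborel. complex_of_real ((cmod (g ((t - 1) + 1 * s)))\<^sup>2))"
      by (rule Bochner_Integration.integral_cong[OF refl]) (simp add: F_def complex_norm_square add.commute mult.commute del: of_real_power)
    also have "\<dots> = (LINT s|lborel. complex_of_real ((cmod (g s))\<^sup>2))"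
      by (subst (2) lborel_integral_real_affine[of 1 _ "t - 1"]) simp_all
    also have "\<dots> = complex_of_real (LINT s|lborel. (cmod (g s))\<^sup>2)" by (rule integral_complex_of_real)
    also have "(LINT s|lborel. (cmod (g s))\<^sup>2) = (L2_norm g)\<^sup>2"
      unfolding L2_norm_def by (subst real_sqrt_pow2) (auto intro: integral_nonneg_AE)
    finally show ?thesis .
  qed
  ultimately show ?thesis by simp
qed

text \<open>
  Expanding both periodizations gives a double series of products of a function of \<open>x\<close> and a
  character in \<open>\<xi>\<close> whose frequency \<open>r = (n/N + l) - (m/N + k)\<close> is a multiple of \<open>1/N\<close>.  The character
  integrates to 0 over \<open>[0, N]\<close> unless \<open>r = 0\<close>, which for \<open>m, n < N\<close> forces \<open>m = n\<close> and \<open>k = l\<close>.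
\<close>
lemma periodization_orthogonality:
  assumes g: "g \<in> feichtinger" and N: "N \<ge> 1" and mn: "m < N" "n < N"
    and Z_eq: "\<And>n p. Z n p = periodization (tf_shift (fst p) (snd p) g) (real n / real N)"
  shows "set_integrable lborel (torus N) (\<lambda>p. cnj (Z m p) * Z n p)"
    and "(LINT p:torus N|lborel. cnj (Z m p) * Z n p) =
      (if m = n then complex_of_real (real N * (L2_norm g)\<^sup>2) else 0)"
proof -
  define y where "y n = real n / real N" for n
  define G where "G n k p = cis (2 * pi * (y n + of_int k) * snd p) * g (y n + of_int k - fst p)" for n and k :: int and p :: "real \<times> real"
  have Z: "Z n p = (\<Sum>\<^sub>\<infinity>k :: int. G n k p)" for n p
    by (simp add: Z_eq periodization_def G_def y_def tf_shift_def modulation_def translation_def mult_ac)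
  obtain B where B: "amalgam_bound B g" by (rule feichtinger_amalgam[OF g])
  define C where "C k = B (k - 1) + B k + B (k + 1)" for k
  have C: "C summable_on UNIV" "norm (G n k p) \<le> C k" if "n < N" "p \<in> torus N" for n k p
  proof -
    show "C summable_on UNIV" unfolding C_def by (rule amalgam_uniform_bound(1)[OF B])
    have "0 \<le> y n" "y n \<le> 1" using that by (auto simp: y_def)
    then have "y n - fst p \<in> {-1..1}" using that by (auto simp: torus_def)
    from amalgam_uniform_bound(2)[OF B this, of k]
    show "norm (G n k p) \<le> C k" by (simp add: G_def C_def norm_mult algebra_simps)
  qed
  have C0: "0 \<le> C k" for k unfolding C_def using amalgam_bound_nonneg[OF B] by simp
  have Cs: "C summable_on UNIV" unfolding C_def by (rule amalgam_uniform_bound(1)[OF B])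
  have contg: "continuous_on A (\<lambda>p. g (h p))" if "continuous_on A h" for A :: "'z :: topological_space set" and h
    by (rule continuous_on_compose2[OF feichtingerD(3)[OF g] that]) auto
  have contG: "continuous_on UNIV (G n k)" for n k
    unfolding G_def by (intro continuous_intros contg)
  have Gs: "(\<lambda>k. norm (G n k p)) summable_on UNIV" for n p
  proof -
    have "(\<lambda>k :: int. norm (g ((y n - fst p) + of_int k))) summable_on UNIV" by (rule feichtinger_samples_summable[OF g])
    then show ?thesis by (simp add: G_def norm_mult algebra_simps)
  qed
  let ?f = "\<lambda>i p. cnj (G m (fst i) p) * G n (snd i) p"
  have prod: "cnj (Z m p) * Z n p = (\<Sum>\<^sub>\<infinity>i\<in>UNIV \<times> UNIV. ?f i p)" for p
    using infsum_times[of "\<lambda>k. cnj (G m k p)" UNIV "\<lambda>k. G n k p" UNIV] Gs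
    by (simp add: Z case_prod_unfold)
  have S: "torus N \<in> sets lborel" "emeasure lborel (torus N) < \<infinity>"
  proof -
    have "compact (torus N)" unfolding torus_def by (intro compact_Times compact_Icc)
    then show "torus N \<in> sets lborel" "emeasure lborel (torus N) < \<infinity>"
      by (simp add: borel_compact, rule emeasure_compact_finite)
  qed
  have inf: "infinite (UNIV \<times> UNIV :: (int \<times> int) set)" by (simp add: finite_prod infinite_UNIV_int)
  have meas: "?f i \<in> borel_measurable lborel" for i
    by (simp, intro borel_measurable_continuous_onI continuous_intros contG)
  have bnd: "norm (?f i p) \<le> C (fst i) * C (snd i)" if "p \<in> torus N" for i p
    unfolding norm_mult complex_mod_cnj using C(2) mn that C0 by (intro mult_mono) auto
  have CC: "(\<lambda>i. C (fst i) * C (snd i)) summable_on UNIV \<times> UNIV"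
    using abs_summable_times[of C UNIV C UNIV] Cs C0 by (simp add: case_prod_unfold abs_mult)
  show "set_integrable lborel (torus N) (\<lambda>p. cnj (Z m p) * Z n p)"
    unfolding prod by (rule has_sum_set_integral_uniform(1)[OF _ inf S meas bnd CC]) auto
  have hs: "((\<lambda>i. LINT p:torus N|lborel. ?f i p) has_sum (LINT p:torus N|lborel. cnj (Z m p) * Z n p)) (UNIV \<times> UNIV)"
    unfolding prod by (rule has_sum_set_integral_uniform(2)[OF _ inf S meas bnd CC]) auto
  have val: "(LINT p:torus N|lborel. ?f (k, l) p) =
     (if m = n \<and> k = l then of_nat N * (LINT x:{0..1}|lborel. cnj (g (y n + of_int k - x)) * g (y n + of_int k - x)) else 0)" for k l
  proof -
    define r where "r = (y n + of_int l) - (y m + of_int k)"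
    have Nr: "real_of_int (int n - int m + int N * (l - k)) = real N * r"
      using N by (simp add: r_def y_def field_simps)
    have "r = 0 \<longleftrightarrow> int n - int m + int N * (l - k) = 0"
      using N Nr by (metis mult_eq_0_iff of_int_eq_0_iff of_nat_eq_0_iff not_one_le_zero)
    also have "\<dots> \<longleftrightarrow> m = n \<and> k = l"
    proof
      assume eq: "int n - int m + int N * (l - k) = 0"
      then have d: "int n - int m = int N * (k - l)" by (simp add: algebra_simps)
      have "k = l"
      proof (rule ccontr)
        assume "k \<noteq> l"
        then have "1 \<le> \<bar>k - l\<bar>" by simp
        then have "int N * 1 \<le> int N * \<bar>k - l\<bar>" by (rule mult_left_mono) simp
        also have "\<dots> = \<bar>int n - int m\<bar>" unfolding d by (simp add: abs_mult)
        finally show False using mn by linarith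
      qed
      then show "m = n \<and> k = l" using d by simp
    qed auto
    finally have r0: "r = 0 \<longleftrightarrow> m = n \<and> k = l" .
    have "?f (k, l) p = (cnj (g (y m + of_int k - fst p)) * g (y n + of_int l - fst p)) * cis (2 * pi * r * snd p)" for p
    proof -
      have "cnj (cis (2 * pi * (y m + of_int k) * snd p)) * cis (2 * pi * (y n + of_int l) * snd p) = cis (2 * pi * r * snd p)"
        by (simp add: cis_cnj cis_mult r_def algebra_simps)
      then show ?thesis by (simp add: G_def mult_ac)
    qed
    then have "(LINT p:torus N|lborel. ?f (k, l) p) = (LINT p:torus N|lborel. (cnj (g (y m + of_int k - fst p)) * g (y n + of_int l - fst p)) * cis (2 * pi * r * snd p))"
      by simp
    also have "\<dots> = (LINT x:{0..1}|lborel. cnj (g (y m + of_int k - x)) * g (y n + of_int l - x)) * (LINT \<xi>:{0..real N}|lborel. cis (2 * pi * r * \<xi>))"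
      by (rule integral_torus_tensor) (intro continuous_intros contg)+
    also have "(LINT \<xi>:{0..real N}|lborel. cis (2 * pi * r * \<xi>)) = (if r = 0 then complex_of_real (real N) else 0)"
      using N by (intro set_integral_cis[OF _ Nr]) simp
    finally show ?thesis unfolding r0 by auto
  qed
  show "(LINT p:torus N|lborel. cnj (Z m p) * Z n p) = (if m = n then complex_of_real (real N * (L2_norm g)\<^sup>2) else 0)"
  proof (cases "m = n")
    case True
    let ?w = "\<lambda>k :: int. of_nat N * (LINT x:{0..1}|lborel. cnj (g (y n + of_int k - x)) * g (y n + of_int k - x))"
    have "(?w has_sum of_nat N * complex_of_real ((L2_norm g)\<^sup>2)) UNIV"
      by (intro has_sum_cmult_right feichtinger_sum_cell_norms g)
    from has_sum_diagonal[OF this]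
    have "((\<lambda>i. if fst i = snd i then ?w (fst i) else 0) has_sum of_nat N * complex_of_real ((L2_norm g)\<^sup>2)) (UNIV \<times> UNIV)"
      by (simp only: case_prod_unfold)
    moreover have "(\<lambda>i. if fst i = snd i then ?w (fst i) else 0) = (\<lambda>i. LINT p:torus N|lborel. ?f i p)"
    proof
      fix i :: "int \<times> int"
      show "(if fst i = snd i then ?w (fst i) else 0) = (LINT p:torus N|lborel. ?f i p)"
        using val[of "fst i" "snd i"] True by simp
    qed
    ultimately have "((\<lambda>i. LINT p:torus N|lborel. ?f i p) has_sum of_nat N * complex_of_real ((L2_norm g)\<^sup>2)) (UNIV \<times> UNIV)"
      by (simp only:)
    from has_sum_unique[OF hs this] show ?thesis using True by simp
  next
    case False
    have "((\<lambda>i. LINT p:torus N|lborel. ?f i p) has_sum 0) (UNIV \<times> UNIV)"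
    proof (rule has_sum_0)
      fix i :: "int \<times> int"
      show "(LINT p:torus N|lborel. ?f i p) = 0" using val[of "fst i" "snd i"] False by simp
    qed
    from has_sum_unique[OF hs this] show ?thesis using False by simp
  qed
qed

lemma set_integral_finite_sum:
  fixes f :: "'i \<Rightarrow> 'a \<Rightarrow> complex"
  assumes "\<And>i. i \<in> I \<Longrightarrow> set_integrable M A (f i)"
  shows "set_integrable M A (\<lambda>x. \<Sum>i\<in>I. f i x)"
    and "(LINT x:A|M. (\<Sum>i\<in>I. f i x)) = (\<Sum>i\<in>I. LINT x:A|M. f i x)"
  using assms unfolding set_integrable_def set_lebesgue_integral_def scaleR_sum_right
  by (auto intro: Bochner_Integration.integrable_sum Bochner_Integration.integral_sum)

text \<open>
  The sum over \<open>m\<close> is the short-time Fourier transform of \<open>\<Sum>m. c\<^sub>m \<epsilon>\<^sub>m\<close>; pairing it with \<open>Z\<^sub>n\<close> singles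
  out the coefficient \<open>c\<^sub>n\<close>.
\<close>
lemma zak_coefficient_extraction:
  assumes g: "g \<in> feichtinger" and N: "N \<ge> 1" and n: "n < N"
    and Z_eq: "\<And>n p. Z n p = periodization (tf_shift (fst p) (snd p) g) (real n / real N)"
  shows "set_integrable lborel (torus N) (\<lambda>p. (\<Sum>m<N. c m * cnj (Z m p)) * Z n p)"
    and "(LINT p:torus N|lborel. (\<Sum>m<N. c m * cnj (Z m p)) * Z n p) = c n * complex_of_real (real N * (L2_norm g)\<^sup>2)"
proof -
  note O = periodization_orthogonality[OF g N _ n Z_eq]
  have eq: "(\<Sum>m<N. c m * cnj (Z m p)) * Z n p = (\<Sum>m<N. c m * (cnj (Z m p) * Z n p))" for p
    by (simp add: sum_distrib_right mult.assoc)
  have i: "set_integrable lborel (torus N) (\<lambda>p. c m * (cnj (Z m p) * Z n p))" if "m < N" for m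
    by (intro set_integrable_mult_right O(1) that)
  show "set_integrable lborel (torus N) (\<lambda>p. (\<Sum>m<N. c m * cnj (Z m p)) * Z n p)"
    unfolding eq using i by (intro set_integral_finite_sum(1)) auto
  have "(LINT p:torus N|lborel. (\<Sum>m<N. c m * cnj (Z m p)) * Z n p) = (\<Sum>m<N. LINT p:torus N|lborel. c m * (cnj (Z m p) * Z n p))"
    unfolding eq using i by (intro set_integral_finite_sum(2)) auto
  also have "\<dots> = (\<Sum>m<N. if m = n then c n * complex_of_real (real N * (L2_norm g)\<^sup>2) else 0)"
    using O(2) by (intro sum.cong refl) simp
  also have "\<dots> = c n * complex_of_real (real N * (L2_norm g)\<^sup>2)"
    using n by simp
  finally show "(LINT p:torus N|lborel. (\<Sum>m<N. c m * cnj (Z m p)) * Z n p) = c n * complex_of_real (real N * (L2_norm g)\<^sup>2)" .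
qed

section \<open>The reproducing formulas\<close>

text \<open>
  If the norm vanishes then so does \<open>V g\<close>, and the reconstruction formula recovers \<open>g = 0\<close> at every
  point.
\<close>
lemma L2_norm_nonzero:
  assumes g: "g \<in> feichtinger" and "g \<noteq> (\<lambda>t. 0)"
  shows "L2_norm g \<noteq> 0"
proof
  note G = feichtingerD[OF g]
  have [measurable]: "g \<in> borel_measurable borel" by (rule G)
  assume "L2_norm g = 0"
  then have "(LINT t|lborel. (cmod (g t))\<^sup>2) = 0" by (simp add: L2_norm_def)
  then have "AE t in lborel. (cmod (g t))\<^sup>2 = 0"
    using G(2) by (subst (asm) integral_nonneg_eq_0_iff_AE) auto
  then have "stft gauss g x \<xi> = 0" for x \<xi>
    unfolding stft_gauss_eq by (intro integral_eq_zero_AE) (auto elim: eventually_mono)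
  then have "g t = 0" for t using feichtinger_reconstruction[OF g, of t] by (simp add: case_prod_unfold)
  with assms(2) show False by auto
qed

theorem theorem11:
  fixes N :: nat and g f :: "real \<Rightarrow> complex" and \<phi> :: functional
  assumes "N \<ge> 1"
    and "g \<in> feichtinger" and "g \<noteq> (\<lambda>t. 0)"
    and "\<phi> \<in> delta_train_span N"
    and "f \<in> feichtinger"
  shows "(\<forall>n<N. set_integrable lborel (torus N)
            (\<lambda>(x, \<xi>). stft_dual g \<phi> x \<xi> * cis (2 * pi * \<xi> * (real n / real N)) *
               zak g (real n / real N - x) (- \<xi>)))
       \<and> \<phi> = (\<lambda>h. 1 / complex_of_real (real N * (L2_norm g)\<^sup>2) *
            (\<Sum>n<N. (LINT (x, \<xi>) : torus N | lborel.
                  stft_dual g \<phi> x \<xi> * cis (2 * pi * \<xi> * (real n / real N)) *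
                  zak g (real n / real N - x) (- \<xi>)) * delta_train N n h))
       \<and> (\<forall>h\<in>feichtinger.
            set_integrable lborel (torus N)
              (\<lambda>(x, \<xi>). stft_dual g (double_periodization N f) x \<xi> *
                 double_periodization N (tf_shift x \<xi> g) h)
            \<and> double_periodization N f h = 1 / complex_of_real ((L2_norm g)\<^sup>2) *
              (LINT (x, \<xi>) : torus N | lborel.
                 stft_dual g (double_periodization N f) x \<xi> *
                 double_periodization N (tf_shift x \<xi> g) h))"
proof -
  note g = \<open>g \<in> feichtinger\<close> and f = \<open>f \<in> feichtinger\<close> and N = \<open>N \<ge> 1\<close>
  define Z where "Z n p = periodization (tf_shift (fst p) (snd p) g) (real n / real N)" for n p
  define \<gamma> where "\<gamma> = complex_of_real ((L2_norm g)\<^sup>2)"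
  have \<gamma>: "\<gamma> \<noteq> 0" "complex_of_real (real N * (L2_norm g)\<^sup>2) = of_nat N * \<gamma>"
    using L2_norm_nonzero[OF g assms(3)] by (simp_all add: \<gamma>_def)
  have N0: "(of_nat N :: complex) \<noteq> 0" using N by simp
  note X = zak_coefficient_extraction[OF g N _ Z_def, unfolded \<gamma>(2)]
  have shifted: "tf_shift x \<xi> g \<in> feichtinger" for x \<xi> by (rule tf_shift_in_feichtinger[OF g])
  obtain c where \<phi>: "\<phi> = (\<lambda>h. \<Sum>m<N. c m * delta_train N m h)"
    using assms(4) by (auto simp: delta_train_span_def)
  have I1: "(\<lambda>(x, \<xi>). stft_dual g \<phi> x \<xi> * cis (2 * pi * \<xi> * (real n / real N)) * zak g (real n / real N - x) (- \<xi>)) =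
      (\<lambda>p. (\<Sum>m<N. c m * cnj (Z m p)) * Z n p)" for n
  proof
    fix p :: "real \<times> real"
    have "stft_dual g \<phi> (fst p) (snd p) = (\<Sum>m<N. c m * cnj (Z m p))"
      using shifted by (simp add: \<phi> stft_dual_def delta_train_eq Z_def)
    moreover have "cis (2 * pi * snd p * (real n / real N)) * zak g (real n / real N - fst p) (- snd p) = Z n p"
      unfolding Z_def by (rule zak_eq_periodization)
    ultimately show "(case p of (x, \<xi>) \<Rightarrow> stft_dual g \<phi> x \<xi> * cis (2 * pi * \<xi> * (real n / real N)) * zak g (real n / real N - x) (- \<xi>)) =
        (\<Sum>m<N. c m * cnj (Z m p)) * Z n p"
      unfolding case_prod_unfold mult.assoc[of "stft_dual g \<phi> (fst p) (snd p)"] by simp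
  qed
  have part1: "\<forall>n<N. set_integrable lborel (torus N)
            (\<lambda>(x, \<xi>). stft_dual g \<phi> x \<xi> * cis (2 * pi * \<xi> * (real n / real N)) *
               zak g (real n / real N - x) (- \<xi>))"
    unfolding I1 using X(1) by blast
  have part2: "\<phi> = (\<lambda>h. 1 / complex_of_real (real N * (L2_norm g)\<^sup>2) *
            (\<Sum>n<N. (LINT (x, \<xi>) : torus N | lborel.
                  stft_dual g \<phi> x \<xi> * cis (2 * pi * \<xi> * (real n / real N)) *
                  zak g (real n / real N - x) (- \<xi>)) * delta_train N n h))"
  proof
    fix h
    have "(\<Sum>n<N. (LINT p:torus N|lborel. (\<Sum>m<N. c m * cnj (Z m p)) * Z n p) * delta_train N n h) =
        (\<Sum>n<N. of_nat N * \<gamma> * (c n * delta_train N n h))"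
      using X(2) by (intro sum.cong refl) simp
    also have "\<dots> = of_nat N * \<gamma> * \<phi> h" by (simp add: \<phi> sum_distrib_left)
    finally show "\<phi> h = 1 / complex_of_real (real N * (L2_norm g)\<^sup>2) *
            (\<Sum>n<N. (LINT (x, \<xi>) : torus N | lborel.
                  stft_dual g \<phi> x \<xi> * cis (2 * pi * \<xi> * (real n / real N)) *
                  zak g (real n / real N - x) (- \<xi>)) * delta_train N n h)"
      unfolding I1 \<gamma>(2) using \<gamma>(1) N0 by simp
  qed
  define a where "a m = periodization f (real m / real N) / of_nat N" for m
  have part3: "set_integrable lborel (torus N)
              (\<lambda>(x, \<xi>). stft_dual g (double_periodization N f) x \<xi> *
                 double_periodization N (tf_shift x \<xi> g) h)
            \<and> double_periodization N f h = 1 / complex_of_real ((L2_norm g)\<^sup>2) *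
              (LINT (x, \<xi>) : torus N | lborel.
                 stft_dual g (double_periodization N f) x \<xi> *
                 double_periodization N (tf_shift x \<xi> g) h)"
    if h: "h \<in> feichtinger" for h
  proof -
    define b where "b n = cnj (periodization h (real n / real N)) / of_nat N" for n
    have dpf: "double_periodization N f u = (\<Sum>m<N. a m * cnj (periodization u (real m / real N)))"
      if "u \<in> feichtinger" for u
      using double_periodization_eq[OF f that N] by (simp add: a_def sum_divide_distrib)
    have dpg: "double_periodization N (tf_shift (fst p) (snd p) g) h = (\<Sum>n<N. Z n p * b n)" for p
      using double_periodization_eq[OF shifted h N, of "fst p" "snd p"] by (simp add: b_def Z_def sum_divide_distrib)
    have I2: "(\<lambda>(x, \<xi>). stft_dual g (double_periodization N f) x \<xi> * double_periodization N (tf_shift x \<xi> g) h) =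
       (\<lambda>p. \<Sum>n<N. b n * ((\<Sum>m<N. a m * cnj (Z m p)) * Z n p))"
    proof
      fix p :: "real \<times> real"
      have "(case p of (x, \<xi>) \<Rightarrow> stft_dual g (double_periodization N f) x \<xi> * double_periodization N (tf_shift x \<xi> g) h) =
         (\<Sum>m<N. a m * cnj (Z m p)) * (\<Sum>n<N. Z n p * b n)"
        using dpf[OF shifted, of "fst p" "snd p"] dpg[of p] by (simp add: stft_dual_def Z_def case_prod_unfold)
      also have "\<dots> = (\<Sum>n<N. b n * ((\<Sum>m<N. a m * cnj (Z m p)) * Z n p))"
        unfolding sum_distrib_left[of _ "\<lambda>n. Z n p * b n"] by (simp add: mult_ac)
      finally show "(case p of (x, \<xi>) \<Rightarrow> stft_dual g (double_periodization N f) x \<xi> * double_periodization N (tf_shift x \<xi> g) h) = \<dots>" .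
    qed
    have i: "set_integrable lborel (torus N) (\<lambda>p. b n * ((\<Sum>m<N. a m * cnj (Z m p)) * Z n p))" if "n < N" for n
      by (intro set_integrable_mult_right X(1) that)
    have "(LINT p:torus N|lborel. (\<Sum>n<N. b n * ((\<Sum>m<N. a m * cnj (Z m p)) * Z n p))) =
       (\<Sum>n<N. LINT p:torus N|lborel. b n * ((\<Sum>m<N. a m * cnj (Z m p)) * Z n p))"
      using i by (intro set_integral_finite_sum(2)) auto
    also have "\<dots> = (\<Sum>n<N. \<gamma> * (a n * cnj (periodization h (real n / real N))))"
      using X(2) N0 by (intro sum.cong refl) (simp add: b_def)
    also have "\<dots> = \<gamma> * double_periodization N f h"
      unfolding dpf[OF h] sum_distrib_left ..
    finally show ?thesis
      unfolding I2 \<gamma>_def[symmetric] using i \<gamma>(1) by (auto intro!: set_integral_finite_sum(1))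
  qed
  show ?thesis using part1 part2 part3 by blast
qed

end
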